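(* Let $R$ be a commutative reduced ring with classical ring of quotients $Q$. Then $R\propto Q/R$ is morphic if and only if $R$ is a Bézout weak Baer ring.
   Context: All rings are associative with identity. A commutative ring is Bézout if every finitely generated ideal is principal. A commutative ring is weak Baer if the annihilator of every element is generated by an idempotent. The classical ring of quotients $Q$ of a commutative ring $R$ is the localization of $R$ at the set of all nonzerodivisors of $R$. For a commutative ring $R$ and an $R$-module $M$ (viewed as an $(R,R)$-bimodule with $mr=rm$), the trivial extension $R\propto M$ is the commutative ring of pairs $(r,m)$ with $r\in R$, $m\in M$, with componentwise addition and multiplication $(r,m)(s,n)=(rs,rn+ms)$. A commutative ring $S$ is morphic if for every $a\in S$ one has $S/Sa\cong\{x\in S: xa=0\}$ as $S$-modules. *)

theory Defs
  imports "HOL-Algebra.QuotRing" "HOL-Algebra.Module"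
begin

text \<open>As everywhere in HOL-Algebra, rings are not required to be nontrivial. The record
  \<open>module\<close> extends \<open>ring\<close>; where the fields \<open>mult\<close> and \<open>one\<close> of a
  module have no meaning they are left \<open>undefined\<close>.\<close>

section \<open>Some classes of commutative rings\<close>

definition annihilator :: "('a, 'm) ring_scheme \<Rightarrow> 'a \<Rightarrow> 'a set"
  where "annihilator R a = {x \<in> carrier R. x \<otimes>\<^bsub>R\<^esub> a = \<zero>\<^bsub>R\<^esub>}"

locale reduced_cring = cring +
  assumes nilpotent_imp_zero:
    "\<lbrakk>x \<in> carrier R; x [^] (n::nat) = \<zero>\<rbrakk> \<Longrightarrow> x = \<zero>"

locale bezout_cring = cring +
  assumes finitely_generated_principal:
    "\<lbrakk>finite A; A \<subseteq> carrier R\<rbrakk> \<Longrightarrow> principalideal (Idl A) R"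

locale weak_baer_cring = cring +
  assumes annihilator_idempotent:
    "a \<in> carrier R \<Longrightarrow> \<exists>e \<in> carrier R. e \<otimes> e = e \<and> annihilator R a = Idl {e}"

section \<open>Localization and the classical ring of quotients\<close>

definition nonzerodivisors :: "('a, 'm) ring_scheme \<Rightarrow> 'a set"
  where "nonzerodivisors R =
    {s \<in> carrier R. \<forall>x \<in> carrier R. x \<otimes>\<^bsub>R\<^esub> s = \<zero>\<^bsub>R\<^esub> \<longrightarrow> x = \<zero>\<^bsub>R\<^esub>}"

definition fraction_rel :: "('a, 'm) ring_scheme \<Rightarrow> 'a set \<Rightarrow> (('a \<times> 'a) \<times> ('a \<times> 'a)) set"
  where "fraction_rel R S = {((a, s), (b, t)).
    a \<in> carrier R \<and> s \<in> S \<and> b \<in> carrier R \<and> t \<in> S \<and>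
    (\<exists>u \<in> S. u \<otimes>\<^bsub>R\<^esub> (a \<otimes>\<^bsub>R\<^esub> t \<ominus>\<^bsub>R\<^esub> b \<otimes>\<^bsub>R\<^esub> s) = \<zero>\<^bsub>R\<^esub>)}"

text \<open>\<open>fraction R S a s\<close> is the fraction \<open>a/s\<close>.\<close>

definition fraction :: "('a, 'm) ring_scheme \<Rightarrow> 'a set \<Rightarrow> 'a \<Rightarrow> 'a \<Rightarrow> ('a \<times> 'a) set"
  where "fraction R S a s = fraction_rel R S `` {(a, s)}"

text \<open>In \<open>mult\<close> and \<open>add\<close> all members of the union coincide, as the operations on
  fractions do not depend on the representatives.\<close>

definition localization :: "('a, 'm) ring_scheme \<Rightarrow> 'a set \<Rightarrow> ('a \<times> 'a) set ring"
  where "localization R S =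
    \<lparr>carrier = (carrier R \<times> S) // fraction_rel R S,
     mult = (\<lambda>U V. \<Union>x \<in> U. \<Union>y \<in> V.
       fraction R S (fst x \<otimes>\<^bsub>R\<^esub> fst y) (snd x \<otimes>\<^bsub>R\<^esub> snd y)),
     one = fraction R S \<one>\<^bsub>R\<^esub> \<one>\<^bsub>R\<^esub>,
     zero = fraction R S \<zero>\<^bsub>R\<^esub> \<one>\<^bsub>R\<^esub>,
     add = (\<lambda>U V. \<Union>x \<in> U. \<Union>y \<in> V.
       fraction R S (fst x \<otimes>\<^bsub>R\<^esub> snd y \<oplus>\<^bsub>R\<^esub> fst y \<otimes>\<^bsub>R\<^esub> snd x) (snd x \<otimes>\<^bsub>R\<^esub> snd y))\<rparr>"

definition classical_quotients :: "('a, 'm) ring_scheme \<Rightarrow> ('a \<times> 'a) set ring"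
  where "classical_quotients R = localization R (nonzerodivisors R)"

definition to_classical_quotients :: "('a, 'm) ring_scheme \<Rightarrow> 'a \<Rightarrow> ('a \<times> 'a) set"
  where "to_classical_quotients R r = fraction R (nonzerodivisors R) r \<one>\<^bsub>R\<^esub>"

section \<open>Modules\<close>

text \<open>A ring \<open>A\<close> as a module over the domain of a ring homomorphism \<open>f\<close> into \<open>A\<close>.\<close>

definition module_via :: "('r \<Rightarrow> 'a) \<Rightarrow> ('a, 'm) ring_scheme \<Rightarrow> ('r, 'a) module"
  where "module_via f A =
    \<lparr>carrier = carrier A, mult = mult A, one = one A, zero = zero A, add = add A,
     smult = (\<lambda>r x. f r \<otimes>\<^bsub>A\<^esub> x)\<rparr>"

definition regular_module :: "('a, 'm) ring_scheme \<Rightarrow> ('a, 'a) module"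
  where "regular_module R = module_via (\<lambda>r. r) R"

definition quotient_module :: "('r, 'a, 'm) module_scheme \<Rightarrow> 'a set \<Rightarrow> ('r, 'a set) module"
  where "quotient_module M N =
    \<lparr>carrier = a_rcosets\<^bsub>M\<^esub> N, mult = undefined, one = undefined,
     zero = N, add = set_add M,
     smult = (\<lambda>r C. \<Union>x \<in> C. N +>\<^bsub>M\<^esub> (r \<odot>\<^bsub>M\<^esub> x))\<rparr>"

definition module_iso ::
    "('r, 'k) ring_scheme \<Rightarrow> ('r, 'a, 'm) module_scheme \<Rightarrow> ('r, 'b, 'n) module_scheme \<Rightarrow> ('a \<Rightarrow> 'b) set"
  where "module_iso R M N = {h. bij_betw h (carrier M) (carrier N) \<and>
    (\<forall>x \<in> carrier M. \<forall>y \<in> carrier M. h (x \<oplus>\<^bsub>M\<^esub> y) = h x \<oplus>\<^bsub>N\<^esub> h y) \<and>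
    (\<forall>r \<in> carrier R. \<forall>x \<in> carrier M. h (r \<odot>\<^bsub>M\<^esub> x) = r \<odot>\<^bsub>N\<^esub> h x)}"

section \<open>Morphic rings and trivial extensions\<close>

locale morphic_cring = cring +
  assumes quotient_iso_annihilator:
    "a \<in> carrier R \<Longrightarrow>
      module_iso R (quotient_module (regular_module R) (PIdl a))
        ((regular_module R)\<lparr>carrier := annihilator R a\<rparr>) \<noteq> {}"

definition trivial_extension ::
    "('r, 'k) ring_scheme \<Rightarrow> ('r, 'a, 'm) module_scheme \<Rightarrow> ('r \<times> 'a) ring"  (infixl \<open>\<propto>\<close> 65)
  where "R \<propto> M =
    \<lparr>carrier = carrier R \<times> carrier M,
     mult = (\<lambda>(r, m) (s, n). (r \<otimes>\<^bsub>R\<^esub> s, r \<odot>\<^bsub>M\<^esub> n \<oplus>\<^bsub>M\<^esub> s \<odot>\<^bsub>M\<^esub> m)),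
     one = (\<one>\<^bsub>R\<^esub>, \<zero>\<^bsub>M\<^esub>),
     zero = (\<zero>\<^bsub>R\<^esub>, \<zero>\<^bsub>M\<^esub>),
     add = (\<lambda>(r, m) (s, n). (r \<oplus>\<^bsub>R\<^esub> s, m \<oplus>\<^bsub>M\<^esub> n))\<rparr>"

text \<open>The \<open>R\<close>-module \<open>Q/R\<close>, where \<open>R\<close> is identified with its image in \<open>Q\<close>.\<close>

definition Q_mod_R :: "('a, 'm) ring_scheme \<Rightarrow> ('a, ('a \<times> 'a) set set) module"
  where "Q_mod_R R = quotient_module (module_via (to_classical_quotients R) (classical_quotients R))
    (to_classical_quotients R ` carrier R)"

end

theory Submission
  imports Defs
begin

text \<open>A commutative ring \<open>S\<close> is morphic iff every \<open>a\<close> has a partner \<open>b\<close> with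
  \<open>ann(a) = Sb\<close> and \<open>ann(b) = Sa\<close>. Let \<open>S = R \<propto> Q/R\<close>.

  If \<open>R\<close> is Bezout and weak Baer, then \<open>r = fu\<close> with \<open>f\<close> idempotent and \<open>u\<close> a
  nonzerodivisor, and \<open>Rq + R = R(1/t)\<close> in \<open>Q\<close>. With \<open>e = 1 - f\<close>, the element \<open>(r, q)\<close>
  generates the same ideal as \<open>(fu, e/t)\<close>, and a partner of the latter is \<open>(et, f/u)\<close>.

  Conversely, a partner \<open>(s, n)\<close> of \<open>(0, a/b)\<close> satisfies \<open>Ra + Rb = R(b/s)\<close>. A partner
  \<open>(s, n)\<close> of \<open>(r, 0)\<close> satisfies \<open>ann(r) = Rs\<close>; as \<open>R\<close> is reduced, \<open>r + s\<close> is a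
  nonzerodivisor, so \<open>Rr + Rs = Rd\<close> with \<open>d\<close> a nonzerodivisor. Writing \<open>r = r'd\<close>,
  \<open>s = s'd\<close>, \<open>1 = wr' + ys'\<close> gives the idempotent generator \<open>ys'\<close> of \<open>ann(r)\<close>.\<close>

section \<open>Quotient modules\<close>

lemma (in module) submodule_imp_abelian_subgroup:
  assumes "submodule N R M"
  shows "abelian_subgroup N M"
  using submodule.axioms(1)[OF assms]
  by (intro abelian_subgroupI3 additive_subgroupI M.abelian_group_axioms)

lemma carrier_quotient_module:
  "carrier (quotient_module M N) = (\<lambda>x. N +>\<^bsub>M\<^esub> x) ` carrier M"
  by (auto simp: quotient_module_def A_RCOSETS_def' a_r_coset_def')

lemma (in module) quotient_module_add:
  assumes "submodule N R M" "x \<in> carrier M" "y \<in> carrier M"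
  shows "(N +>\<^bsub>M\<^esub> x) \<oplus>\<^bsub>quotient_module M N\<^esub> (N +>\<^bsub>M\<^esub> y) = N +>\<^bsub>M\<^esub> (x \<oplus>\<^bsub>M\<^esub> y)"
proof -
  interpret N: abelian_subgroup N M
    by (rule submodule_imp_abelian_subgroup[OF assms(1)])
  show ?thesis
    using assms by (simp add: quotient_module_def N.a_rcos_sum)
qed

lemma (in module) quotient_module_eq_iff:
  assumes "submodule N R M" "x \<in> carrier M" "y \<in> carrier M"
  shows "N +>\<^bsub>M\<^esub> x = N +>\<^bsub>M\<^esub> y \<longleftrightarrow> (\<exists>n\<in>N. x = n \<oplus>\<^bsub>M\<^esub> y)"
proof -
  interpret N: abelian_subgroup N M
    by (rule submodule_imp_abelian_subgroup[OF assms(1)])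
  have "N +>\<^bsub>M\<^esub> x = N +>\<^bsub>M\<^esub> y \<longleftrightarrow> x \<in> N +>\<^bsub>M\<^esub> y"
    using assms N.a_rcos_self M.a_repr_independence N.a_subgroup by metis
  then show ?thesis
    by (auto simp: a_r_coset_def')
qed

text \<open>Scalar multiplication on the quotient is a union over all representatives. Two
  representatives differ by an element of \<open>N\<close>, and \<open>r\<close> keeps
  \<open>N\<close> inside itself, so all cosets in the union coincide and it collapses to one of
  them.\<close>

lemma (in module) quotient_module_smult:
  assumes N: "submodule N R M" and r: "r \<in> carrier R" and x: "x \<in> carrier M"
  shows "r \<odot>\<^bsub>quotient_module M N\<^esub> (N +>\<^bsub>M\<^esub> x) = N +>\<^bsub>M\<^esub> (r \<odot>\<^bsub>M\<^esub> x)"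
proof -
  interpret N: abelian_subgroup N M
    by (rule submodule_imp_abelian_subgroup[OF N])
  have "N +>\<^bsub>M\<^esub> (r \<odot>\<^bsub>M\<^esub> y) = N +>\<^bsub>M\<^esub> (r \<odot>\<^bsub>M\<^esub> x)" if y: "y \<in> N +>\<^bsub>M\<^esub> x" for y
  proof -
    obtain n where n: "n \<in> N" "y = n \<oplus>\<^bsub>M\<^esub> x"
      using y by (auto simp: a_r_coset_def')
    have "r \<odot>\<^bsub>M\<^esub> n \<in> N"
      using submodule.smult_closed[OF N] r n by blast
    moreover have "r \<odot>\<^bsub>M\<^esub> y = r \<odot>\<^bsub>M\<^esub> n \<oplus>\<^bsub>M\<^esub> r \<odot>\<^bsub>M\<^esub> x"
      using n r x by (simp add: smult_r_distr)
    moreover have "y \<in> carrier M"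
      using n x by simp
    ultimately show ?thesis
      using quotient_module_eq_iff[OF N, of "r \<odot>\<^bsub>M\<^esub> y" "r \<odot>\<^bsub>M\<^esub> x"] r x by auto
  qed
  then have "(\<Union>y\<in>N +>\<^bsub>M\<^esub> x. N +>\<^bsub>M\<^esub> (r \<odot>\<^bsub>M\<^esub> y)) = N +>\<^bsub>M\<^esub> (r \<odot>\<^bsub>M\<^esub> x)"
    using N.a_rcos_self[OF x] by (intro SUP_eq_const) blast+
  then show ?thesis
    by (simp add: quotient_module_def)
qed

lemma (in module) quotient_module_zero:
  assumes "submodule N R M"
  shows "\<zero>\<^bsub>quotient_module M N\<^esub> = N +>\<^bsub>M\<^esub> \<zero>\<^bsub>M\<^esub>"
proof -
  interpret N: abelian_subgroup N M
    by (rule submodule_imp_abelian_subgroup[OF assms])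
  show ?thesis
    using N.a_subset by (simp add: quotient_module_def)
qed

lemma (in module) quotient_module_is_module:
  assumes N: "submodule N R M"
  shows "module R (quotient_module M N)"
proof -
  let ?Q = "quotient_module M N"
  define c where "c x = N +>\<^bsub>M\<^esub> x" for x
  have car: "carrier ?Q = c ` carrier M"
    by (simp add: carrier_quotient_module c_def)
  have add: "c x \<oplus>\<^bsub>?Q\<^esub> c y = c (x \<oplus>\<^bsub>M\<^esub> y)" if "x \<in> carrier M" "y \<in> carrier M" for x y
    using quotient_module_add[OF N that] by (simp add: c_def)
  have smult: "r \<odot>\<^bsub>?Q\<^esub> c x = c (r \<odot>\<^bsub>M\<^esub> x)" if "r \<in> carrier R" "x \<in> carrier M" for r x
    using quotient_module_smult[OF N that] by (simp add: c_def)
  have zero: "\<zero>\<^bsub>?Q\<^esub> = c \<zero>\<^bsub>M\<^esub>"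
    using quotient_module_zero[OF N] by (simp add: c_def)
  show ?thesis
  proof (rule moduleI)
    show "abelian_group ?Q"
    proof (rule abelian_groupI)
      show "\<exists>y\<in>carrier ?Q. y \<oplus>\<^bsub>?Q\<^esub> x = \<zero>\<^bsub>?Q\<^esub>" if "x \<in> carrier ?Q" for x
      proof -
        obtain m where "m \<in> carrier M" "x = c m"
          using \<open>x \<in> carrier ?Q\<close> unfolding car by (rule imageE)
        then show ?thesis
          by (intro bexI[of _ "c (\<ominus>\<^bsub>M\<^esub> m)"]) (auto simp: car add zero M.l_neg)
      qed
    qed (auto simp: car add zero M.a_ac)
  qed (auto simp: car add smult R.is_cring smult_l_distr smult_r_distr smult_assoc1)
qed

section \<open>Morphic commutative rings\<close>

lemma (in cring) regular_module_is_module: "module R (regular_module R)"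
proof (rule moduleI)
  show "abelian_group (regular_module R)"
  proof (rule abelian_groupI)
    show "\<exists>y\<in>carrier (regular_module R). y \<oplus>\<^bsub>regular_module R\<^esub> x = \<zero>\<^bsub>regular_module R\<^esub>"
      if "x \<in> carrier (regular_module R)" for x
      using that by (intro bexI[of _ "\<ominus> x"]) (auto simp: regular_module_def module_via_def l_neg)
  qed (auto simp: regular_module_def module_via_def a_ac)
qed (auto simp: regular_module_def module_via_def is_cring l_distr r_distr m_assoc)

lemma (in cring) PIdl_submodule:
  assumes "a \<in> carrier R"
  shows "submodule (PIdl a) R (regular_module R)"
proof -
  interpret ideal "PIdl a" R
    by (rule cgenideal_ideal[OF assms])
  \<comment> \<open>Negatives depend only on the carrier, addition and zero, which the two records
    share; this carries closure of the ideal under negation over to the module.\<close>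
  have "a_inv (regular_module R) = a_inv R"
    by (simp add: a_inv_def m_inv_def regular_module_def module_via_def fun_eq_iff)
  then show ?thesis
    using a_subset
    by (intro module.submoduleI[OF regular_module_is_module])
      (auto simp: regular_module_def module_via_def I_l_closed)
qed

lemma (in cring) PIdl_image: "PIdl a = (\<lambda>x. x \<otimes> a) ` carrier R"
  by (auto simp: cgenideal_def)

text \<open>If \<open>w = c v\<close>, then whatever kills \<open>v\<close> kills \<open>w\<close>.
  Equal principal ideals have generators that are multiples of each other, so this applies in both
  directions.\<close>

lemma (in cring) annihilator_eq_of_PIdl_eq:
  assumes a: "a \<in> carrier R" and b: "b \<in> carrier R" and eq: "PIdl a = PIdl b"
  shows "annihilator R a = annihilator R b"
proof -
  have sub: "annihilator R v \<subseteq> annihilator R w"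
    if v: "v \<in> carrier R" and "w \<in> PIdl v" for v w
  proof -
    obtain c where c: "c \<in> carrier R" "w = c \<otimes> v"
      using \<open>w \<in> PIdl v\<close> by (auto simp: cgenideal_def)
    have "x \<otimes> w = c \<otimes> (x \<otimes> v)" if "x \<in> carrier R" for x
      unfolding c(2) by (rule m_lcomm[OF that c(1) v])
    then show ?thesis
      using c(1) by (auto simp: annihilator_def)
  qed
  show ?thesis
  proof
    show "annihilator R a \<subseteq> annihilator R b"
      by (rule sub[OF a]) (simp add: eq b cgenideal_self)
    show "annihilator R b \<subseteq> annihilator R a"
      by (rule sub[OF b]) (simp add: a cgenideal_self flip: eq)
  qed
qed

lemma (in abelian_group) minus_eq_zero_iff:
  assumes "x \<in> carrier G" "y \<in> carrier G"
  shows "x \<ominus> y = \<zero> \<longleftrightarrow> x = y"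
  using assms by (metis minus_eq a_inv_closed minus_equality minus_minus r_neg)

text \<open>The generator \<open>b\<close> is the image of \<open>1\<close> under an isomorphism
  \<open>R/Ra \<cong> ann(a)\<close>; conversely right multiplication by \<open>b\<close> induces such an
  isomorphism.\<close>

theorem (in cring) morphic_cring_iff:
  "morphic_cring R \<longleftrightarrow>
    (\<forall>a\<in>carrier R. \<exists>b\<in>carrier R. annihilator R a = PIdl b \<and> annihilator R b = PIdl a)"
proof -
  let ?M = "regular_module R"
  interpret M: module R ?M
    by (rule regular_module_is_module)
  have M_simps [simp]: "carrier ?M = carrier R" "add ?M = add R" "zero ?M = zero R"
      "smult ?M = mult R"
    by (auto simp: regular_module_def module_via_def)
  have "module_iso R (quotient_module ?M (PIdl a)) (?M\<lparr>carrier := annihilator R a\<rparr>) \<noteq> {} \<longleftrightarrow>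
      (\<exists>b\<in>carrier R. annihilator R a = PIdl b \<and> annihilator R b = PIdl a)"
    (is "?iso \<longleftrightarrow> ?partner") if a: "a \<in> carrier R" for a
  proof -
    let ?c = "\<lambda>x. PIdl a +>\<^bsub>?M\<^esub> x"
    note N = PIdl_submodule[OF a]
    have eq_iff: "?c x = ?c y \<longleftrightarrow> x \<ominus> y \<in> PIdl a" if "x \<in> carrier R" "y \<in> carrier R" for x y
    proof -
      interpret I: ideal "PIdl a" R
        by (rule cgenideal_ideal[OF a])
      have "(\<exists>n\<in>PIdl a. x = n \<oplus> y) \<longleftrightarrow> x \<ominus> y \<in> PIdl a"
      proof
        assume "\<exists>n\<in>PIdl a. x = n \<oplus> y"
        then obtain n where n: "n \<in> PIdl a" "x = n \<oplus> y"
          by blast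
        then have "x \<ominus> y = n"
          using that I.a_Hcarr[OF n(1)] by (simp add: minus_eq a_assoc r_neg)
        then show "x \<ominus> y \<in> PIdl a"
          using n by simp
      next
        assume "x \<ominus> y \<in> PIdl a"
        moreover have "x = (x \<ominus> y) \<oplus> y"
          using that by (simp add: minus_eq a_assoc l_neg)
        ultimately show "\<exists>n\<in>PIdl a. x = n \<oplus> y"
          by blast
      qed
      then show ?thesis
        using M.quotient_module_eq_iff[OF N] that by simp
    qed
    have car: "carrier (quotient_module ?M (PIdl a)) = ?c ` carrier R"
      by (simp add: carrier_quotient_module)
    note add = M.quotient_module_add[OF N, simplified] and smult = M.quotient_module_smult[OF N, simplified]
    show ?thesis
    proof
      assume ?iso
      then obtain h where bij: "bij_betw h (?c ` carrier R) (annihilator R a)"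
        and lin: "\<And>r x. r \<in> carrier R \<Longrightarrow> x \<in> carrier R \<Longrightarrow> h (?c (r \<otimes> x)) = r \<otimes> h (?c x)"
        by (fastforce simp: module_iso_def car smult)
      define b where "b = h (?c \<one>)"
      have b: "b \<in> carrier R"
        using bij_betwE[OF bij] by (auto simp: b_def annihilator_def)
      have h: "h (?c x) = x \<otimes> b" if "x \<in> carrier R" for x
        using lin[OF that one_closed] that by (simp add: b_def)
      have "annihilator R a = (\<lambda>x. h (?c x)) ` carrier R"
        using bij_betw_imp_surj_on[OF bij] by (auto simp: image_image)
      also have "\<dots> = PIdl b"
        by (simp add: PIdl_image[of b] h cong: image_cong_simp)
      finally have 1: "annihilator R a = PIdl b" .
      \<comment> \<open>As \<open>h\<close> sends the class of \<open>x\<close> to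
        \<open>x b\<close>, the equation \<open>x b = 0\<close> compares the values of
        \<open>h\<close> at the classes of \<open>x\<close> and \<open>0\<close>; injectivity turns
        it into membership in \<open>Ra\<close>.\<close>
      have "x \<in> annihilator R b \<longleftrightarrow> x \<in> PIdl a" if x: "x \<in> carrier R" for x
      proof -
        have "x \<in> annihilator R b \<longleftrightarrow> h (?c x) = h (?c \<zero>)"
          using x b by (simp add: annihilator_def h)
        also have "\<dots> \<longleftrightarrow> ?c x = ?c \<zero>"
          using bij x by (auto simp: bij_betw_def inj_on_def)
        also have "\<dots> \<longleftrightarrow> x \<in> PIdl a"
          using x by (simp add: eq_iff minus_eq)
        finally show ?thesis .
      qed
      moreover have "PIdl a \<subseteq> carrier R" "annihilator R b \<subseteq> carrier R"
        using a by (auto simp: cgenideal_def annihilator_def)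
      ultimately have "annihilator R b = PIdl a"
        by blast
      with 1 b show ?partner
        by blast
    next
      assume ?partner
      then obtain b where b: "b \<in> carrier R" and ann_a: "annihilator R a = PIdl b"
        and ann_b: "annihilator R b = PIdl a"
        by blast
      \<comment> \<open>The map \<open>x \<mapsto> x b\<close> has kernel
        \<open>ann(b) = Ra\<close>, so its value depends only on the coset of \<open>x\<close> and
        separates cosets. This makes the description unique and \<open>h\<close> injective.\<close>
      define h where "h C = (THE y. \<exists>x\<in>carrier R. C = ?c x \<and> y = x \<otimes> b)" for C
      have c_eq: "?c x = ?c y \<longleftrightarrow> x \<otimes> b = y \<otimes> b" if "x \<in> carrier R" "y \<in> carrier R" for x y
      proof -
        have "(x \<ominus> y) \<otimes> b = \<zero> \<longleftrightarrow> x \<otimes> b = y \<otimes> b"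
          using that b minus_eq_zero_iff[of "x \<otimes> b" "y \<otimes> b"]
          by (simp add: l_distr l_minus minus_eq)
        then show ?thesis
          using eq_iff[OF that] that by (simp add: ann_b[symmetric] annihilator_def)
      qed
      have h: "h (?c x) = x \<otimes> b" if "x \<in> carrier R" for x
        unfolding h_def using that c_eq by (intro the_equality) auto
      have "bij_betw h (?c ` carrier R) (annihilator R a)"
        unfolding bij_betw_def
      proof
        show "inj_on h (?c ` carrier R)"
          by (auto simp: inj_on_def h c_eq)
        show "h ` ?c ` carrier R = annihilator R a"
          by (simp add: ann_a PIdl_image[of b] image_image h cong: image_cong_simp)
      qed
      then have "h \<in> module_iso R (quotient_module ?M (PIdl a)) (?M\<lparr>carrier := annihilator R a\<rparr>)"
        using b by (auto simp: module_iso_def car add smult h l_distr m_assoc)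
      then show ?iso
        by blast
    qed
  qed
  then show ?thesis
    by (simp add: morphic_cring_def morphic_cring_axioms_def is_cring Ball_def)
qed

section \<open>Trivial extensions\<close>

lemma trivial_extension_simps [simp]:
  "carrier (R \<propto> M) = carrier R \<times> carrier M"
  "(r, m) \<otimes>\<^bsub>R \<propto> M\<^esub> (s, n) = (r \<otimes>\<^bsub>R\<^esub> s, r \<odot>\<^bsub>M\<^esub> n \<oplus>\<^bsub>M\<^esub> s \<odot>\<^bsub>M\<^esub> m)"
  "\<one>\<^bsub>R \<propto> M\<^esub> = (\<one>\<^bsub>R\<^esub>, \<zero>\<^bsub>M\<^esub>)"
  "\<zero>\<^bsub>R \<propto> M\<^esub> = (\<zero>\<^bsub>R\<^esub>, \<zero>\<^bsub>M\<^esub>)"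
  "(r, m) \<oplus>\<^bsub>R \<propto> M\<^esub> (s, n) = (r \<oplus>\<^bsub>R\<^esub> s, m \<oplus>\<^bsub>M\<^esub> n)"
  by (auto simp: trivial_extension_def)

lemma (in module) trivial_extension_cring: "cring (R \<propto> M)"
proof (rule cringI)
  show "abelian_group (R \<propto> M)"
  proof (rule abelian_groupI)
    show "\<exists>y\<in>carrier (R \<propto> M). y \<oplus>\<^bsub>R \<propto> M\<^esub> x = \<zero>\<^bsub>R \<propto> M\<^esub>" if "x \<in> carrier (R \<propto> M)" for x
      using that by (intro bexI[of _ "(\<ominus> fst x, \<ominus>\<^bsub>M\<^esub> snd x)"]) (auto simp: R.l_neg M.l_neg)
  qed (auto simp: R.a_ac M.a_ac)
  show "comm_monoid (R \<propto> M)"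
  proof (rule comm_monoidI)
    show "x \<otimes>\<^bsub>R \<propto> M\<^esub> y \<otimes>\<^bsub>R \<propto> M\<^esub> z = x \<otimes>\<^bsub>R \<propto> M\<^esub> (y \<otimes>\<^bsub>R \<propto> M\<^esub> z)"
      if "x \<in> carrier (R \<propto> M)" "y \<in> carrier (R \<propto> M)" "z \<in> carrier (R \<propto> M)" for x y z
      using that
      by (cases x; cases y; cases z)
        (auto simp: R.m_ac M.a_ac smult_r_distr simp flip: smult_assoc1)
  qed (auto simp: R.m_comm M.a_comm)
qed (auto simp: R.l_distr smult_l_distr smult_r_distr M.a_ac)

text \<open>The idempotent \<open>f\<close> splits the second coordinate. On the
  \<open>e\<close>-part, \<open>p\<close> and \<open>q\<close> are multiples of each other while
  \<open>e\<close> kills \<open>v\<close>; on the \<open>f\<close>-part, \<open>q\<close> is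
  absorbed because \<open>f q = v y\<close>. Hence the multipliers \<open>(f + e d, y)\<close> and
  \<open>(f + e c, -y)\<close> carry each generator to the other.\<close>

lemma (in module) trivial_extension_PIdl_eq:
  assumes car: "f \<in> carrier R" "v \<in> carrier R" "c \<in> carrier R" "d \<in> carrier R"
      "p \<in> carrier M" "q \<in> carrier M" "y \<in> carrier M"
    and e: "e = \<one> \<ominus> f" and f: "f \<otimes> f = f" "f \<otimes> v = v"
    and pq: "p = c \<odot>\<^bsub>M\<^esub> q" "q = d \<odot>\<^bsub>M\<^esub> p"
    and y: "v \<odot>\<^bsub>M\<^esub> y = f \<odot>\<^bsub>M\<^esub> q"
  shows "PIdl\<^bsub>R \<propto> M\<^esub> (v, q) = PIdl\<^bsub>R \<propto> M\<^esub> (v, e \<odot>\<^bsub>M\<^esub> p)"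
proof -
  interpret T: cring "R \<propto> M"
    by (rule trivial_extension_cring)
  have e_closed: "e \<in> carrier R"
    using car by (simp add: e)
  have fe: "f \<oplus> e = \<one>"
    unfolding e using car(1) by algebra
  have ev: "e \<otimes> v = \<zero>"
  proof -
    have "e \<otimes> v = v \<ominus> f \<otimes> v"
      unfolding e using car by algebra
    then show ?thesis
      using car f by (simp add: R.minus_eq R.r_neg)
  qed
  have xv: "(f \<oplus> e \<otimes> k) \<otimes> v = v" if "k \<in> carrier R" for k
  proof -
    have "(f \<oplus> e \<otimes> k) \<otimes> v = f \<otimes> v \<oplus> k \<otimes> (e \<otimes> v)"
      using that car e_closed by algebra
    then show ?thesis
      using that car by (simp add: f ev)
  qed
  have ee: "e \<otimes> e = e" "f \<otimes> e = \<zero>"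
  proof -
    have "f \<otimes> e = f \<ominus> f \<otimes> f"
      unfolding e using car(1) by algebra
    then show fe0: "f \<otimes> e = \<zero>"
      using f car by (simp add: R.minus_eq R.r_neg)
    have "e \<otimes> e = e \<ominus> f \<otimes> e"
      using car(1) unfolding e by algebra
    then show "e \<otimes> e = e"
      using fe0 e_closed by (simp add: R.minus_eq)
  qed
  have q_split: "q = f \<odot>\<^bsub>M\<^esub> q \<oplus>\<^bsub>M\<^esub> e \<odot>\<^bsub>M\<^esub> q"
    using smult_l_distr[of f e q] car e_closed by (simp add: fe)
  have "(f \<oplus> e \<otimes> d) \<otimes> e = (f \<otimes> e) \<oplus> (e \<otimes> e) \<otimes> d"
    using car e_closed by algebra
  also have "\<dots> = e \<otimes> d"
    using car e_closed by (simp add: ee)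
  finally have "(f \<oplus> e \<otimes> d) \<odot>\<^bsub>M\<^esub> (e \<odot>\<^bsub>M\<^esub> p) = e \<odot>\<^bsub>M\<^esub> q"
    using car e_closed pq(2) by (simp flip: smult_assoc1)
  then have 1: "(v, q) = (f \<oplus> e \<otimes> d, y) \<otimes>\<^bsub>R \<propto> M\<^esub> (v, e \<odot>\<^bsub>M\<^esub> p)"
    using car e_closed q_split xv y by (simp add: M.a_comm)
  have "(f \<oplus> e \<otimes> c) \<odot>\<^bsub>M\<^esub> q = f \<odot>\<^bsub>M\<^esub> q \<oplus>\<^bsub>M\<^esub> e \<odot>\<^bsub>M\<^esub> p"
    using car e_closed pq(1) by (simp add: smult_l_distr smult_assoc1)
  moreover have "v \<odot>\<^bsub>M\<^esub> (\<ominus>\<^bsub>M\<^esub> y) = \<ominus>\<^bsub>M\<^esub> (f \<odot>\<^bsub>M\<^esub> q)"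
    using car y by (simp add: smult_r_minus)
  ultimately have 2: "(v, e \<odot>\<^bsub>M\<^esub> p) = (f \<oplus> e \<otimes> c, \<ominus>\<^bsub>M\<^esub> y) \<otimes>\<^bsub>R \<propto> M\<^esub> (v, q)"
    using car e_closed xv by (simp add: M.r_neg M.r_neg1 M.r_neg2 M.a_ac)
  have in_car: "(v, q) \<in> carrier (R \<propto> M)" "(v, e \<odot>\<^bsub>M\<^esub> p) \<in> carrier (R \<propto> M)"
    "(f \<oplus> e \<otimes> d, y) \<in> carrier (R \<propto> M)" "(f \<oplus> e \<otimes> c, \<ominus>\<^bsub>M\<^esub> y) \<in> carrier (R \<propto> M)"
    using car e_closed by auto
  have "(v, q) \<in> PIdl\<^bsub>R \<propto> M\<^esub> (v, e \<odot>\<^bsub>M\<^esub> p)"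
    unfolding cgenideal_def using 1 in_car(3) by blast
  moreover have "(v, e \<odot>\<^bsub>M\<^esub> p) \<in> PIdl\<^bsub>R \<propto> M\<^esub> (v, q)"
    unfolding cgenideal_def using 2 in_car(4) by blast
  ultimately show ?thesis
    using in_car(1,2) by (intro subset_antisym T.cgenideal_minimal T.cgenideal_ideal)
qed

section \<open>Fractions with nonzerodivisor denominators\<close>

context cring
begin

lemma nonzerodivisors_closed: "s \<in> nonzerodivisors R \<Longrightarrow> s \<in> carrier R"
  by (simp add: nonzerodivisors_def)

lemma nonzerodivisors_one: "\<one> \<in> nonzerodivisors R"
  by (simp add: nonzerodivisors_def)

lemma nonzerodivisorsI:
  assumes "s \<in> carrier R" "\<And>x. x \<in> carrier R \<Longrightarrow> x \<otimes> s = \<zero> \<Longrightarrow> x = \<zero>"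
  shows "s \<in> nonzerodivisors R"
  using assms unfolding nonzerodivisors_def by blast

lemma nonzerodivisors_mult_eq_zero:
  assumes "s \<in> nonzerodivisors R" "x \<in> carrier R"
  shows "x \<otimes> s = \<zero> \<longleftrightarrow> x = \<zero>" "s \<otimes> x = \<zero> \<longleftrightarrow> x = \<zero>"
proof -
  have s: "s \<in> carrier R"
    by (rule nonzerodivisors_closed[OF assms(1)])
  have "x = \<zero>" if "x \<otimes> s = \<zero>"
    using assms that unfolding nonzerodivisors_def by blast
  then show *: "x \<otimes> s = \<zero> \<longleftrightarrow> x = \<zero>"
    using s by auto
  show "s \<otimes> x = \<zero> \<longleftrightarrow> x = \<zero>"
    using * m_comm[OF s assms(2)] by simp
qed

lemma nonzerodivisors_mult:
  assumes "s \<in> nonzerodivisors R" "t \<in> nonzerodivisors R"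
  shows "s \<otimes> t \<in> nonzerodivisors R"
proof (rule nonzerodivisorsI)
  fix x assume x: "x \<in> carrier R" "x \<otimes> (s \<otimes> t) = \<zero>"
  then have "x \<otimes> s \<otimes> t = \<zero>"
    using assms by (simp add: nonzerodivisors_closed m_assoc)
  then show "x = \<zero>"
    using assms x(1) by (simp add: nonzerodivisors_mult_eq_zero nonzerodivisors_closed)
qed (simp add: assms nonzerodivisors_closed)

lemma nonzerodivisors_factor:
  assumes "s \<otimes> t \<in> nonzerodivisors R" "s \<in> carrier R" "t \<in> carrier R"
  shows "s \<in> nonzerodivisors R"
proof (rule nonzerodivisorsI)
  fix x assume x: "x \<in> carrier R" "x \<otimes> s = \<zero>"
  then have "x \<otimes> (s \<otimes> t) = \<zero>"
    using assms(2,3) by (simp flip: m_assoc)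
  then show "x = \<zero>"
    using assms(1) x(1) by (simp add: nonzerodivisors_mult_eq_zero)
qed (rule assms(2))

lemma nonzerodivisors_cancel:
  assumes "s \<in> nonzerodivisors R" "x \<in> carrier R" "y \<in> carrier R"
  shows "x \<otimes> s = y \<otimes> s \<longleftrightarrow> x = y"
proof -
  have s: "s \<in> carrier R"
    by (rule nonzerodivisors_closed[OF assms(1)])
  have "(x \<ominus> y) \<otimes> s = x \<otimes> s \<ominus> y \<otimes> s"
    using s assms by algebra
  then have "x \<otimes> s = y \<otimes> s \<longleftrightarrow> (x \<ominus> y) \<otimes> s = \<zero>"
    using s assms by (simp add: minus_eq_zero_iff)
  then show ?thesis
    using assms by (simp add: nonzerodivisors_mult_eq_zero minus_eq_zero_iff)
qed

text \<open>The factor \<open>u\<close> in the general definition of equal fractions is a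
  nonzerodivisor and cancels; conversely \<open>u = 1\<close> serves. Only cross multiplication
  remains.\<close>

lemma fraction_rel_iff:
  "((a, s), (b, t)) \<in> fraction_rel R (nonzerodivisors R) \<longleftrightarrow>
    a \<in> carrier R \<and> s \<in> nonzerodivisors R \<and> b \<in> carrier R \<and> t \<in> nonzerodivisors R \<and>
    a \<otimes> t = b \<otimes> s"
proof -
  have "(\<exists>u\<in>nonzerodivisors R. u \<otimes> (a \<otimes> t \<ominus> b \<otimes> s) = \<zero>) \<longleftrightarrow> a \<otimes> t = b \<otimes> s"
    if "a \<in> carrier R" "s \<in> nonzerodivisors R" "b \<in> carrier R" "t \<in> nonzerodivisors R"
    using that nonzerodivisors_one
    by (auto simp: nonzerodivisors_mult_eq_zero minus_eq_zero_iff nonzerodivisors_closed)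
  then show ?thesis
    by (auto simp: fraction_rel_def)
qed

lemma equiv_fraction_rel:
  "equiv (carrier R \<times> nonzerodivisors R) (fraction_rel R (nonzerodivisors R))"
proof (rule equivI)
  show "fraction_rel R (nonzerodivisors R)
      \<subseteq> (carrier R \<times> nonzerodivisors R) \<times> (carrier R \<times> nonzerodivisors R)"
    by (auto simp: fraction_rel_iff)
  show "refl_on (carrier R \<times> nonzerodivisors R) (fraction_rel R (nonzerodivisors R))"
    by (auto simp: refl_on_def fraction_rel_iff)
  show "sym (fraction_rel R (nonzerodivisors R))"
    by (auto simp: sym_def fraction_rel_iff)
  show "trans (fraction_rel R (nonzerodivisors R))"
  proof (rule transI, clarify)
    fix a s b t c u
    assume "((a, s), (b, t)) \<in> fraction_rel R (nonzerodivisors R)"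
      "((b, t), (c, u)) \<in> fraction_rel R (nonzerodivisors R)"
    then have *: "a \<in> carrier R" "s \<in> nonzerodivisors R" "b \<in> carrier R" "t \<in> nonzerodivisors R"
      "c \<in> carrier R" "u \<in> nonzerodivisors R" "a \<otimes> t = b \<otimes> s" "b \<otimes> u = c \<otimes> t"
      by (auto simp: fraction_rel_iff)
    note closed = this(2,4,6)[THEN nonzerodivisors_closed] this(1,3,5)
    \<comment> \<open>The goal \<open>a u = c s\<close> is proved after multiplication by the middle
      denominator \<open>t\<close>, which is then cancelled.\<close>
    have "(a \<otimes> u) \<otimes> t = (a \<otimes> t) \<otimes> u"
      using closed by algebra
    also have "\<dots> = (b \<otimes> u) \<otimes> s"
      unfolding *(7) using closed by algebra
    also have "\<dots> = (c \<otimes> s) \<otimes> t"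
      unfolding *(8) using closed by algebra
    finally show "((a, s), (c, u)) \<in> fraction_rel R (nonzerodivisors R)"
      using * closed by (simp add: fraction_rel_iff nonzerodivisors_cancel)
  qed
qed

section \<open>Arithmetic of fractions in the classical ring of quotients\<close>

abbreviation frac :: "'a \<Rightarrow> 'a \<Rightarrow> ('a \<times> 'a) set"
  where "frac \<equiv> fraction R (nonzerodivisors R)"

lemma frac_eq_iff:
  assumes "a \<in> carrier R" "s \<in> nonzerodivisors R" "b \<in> carrier R" "t \<in> nonzerodivisors R"
  shows "frac a s = frac b t \<longleftrightarrow> a \<otimes> t = b \<otimes> s"
  using assms by (simp add: fraction_def eq_equiv_class_iff[OF equiv_fraction_rel] fraction_rel_iff)

lemma carrier_classical_quotients:
  "carrier (classical_quotients R) = {frac a s | a s. a \<in> carrier R \<and> s \<in> nonzerodivisors R}"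
  by (auto simp: classical_quotients_def localization_def quotient_def fraction_def)

text \<open>Multiplication is a union over representatives. Once the product fraction is known to
  respect the relation in both arguments (\<open>congruent2\<close>), the union reduces to its value
  at the given representatives.\<close>

lemma classical_quotients_mult:
  assumes "a \<in> carrier R" "s \<in> nonzerodivisors R" "b \<in> carrier R" "t \<in> nonzerodivisors R"
  shows "frac a s \<otimes>\<^bsub>classical_quotients R\<^esub> frac b t = frac (a \<otimes> b) (s \<otimes> t)"
proof -
  let ?r = "fraction_rel R (nonzerodivisors R)"
  let ?f = "\<lambda>x y. frac (fst x \<otimes> fst y) (snd x \<otimes> snd y)"
  have "congruent2 ?r ?r ?f"
  proof (rule congruent2I', clarsimp simp: fraction_rel_iff)
    fix a s a' s' b t b' t'
    assume *: "a \<in> carrier R" "s \<in> nonzerodivisors R" "a' \<in> carrier R" "s' \<in> nonzerodivisors R"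
      "b \<in> carrier R" "t \<in> nonzerodivisors R" "b' \<in> carrier R" "t' \<in> nonzerodivisors R"
      and eq: "a \<otimes> s' = a' \<otimes> s" "b \<otimes> t' = b' \<otimes> t"
    note closed = *(2,4,6,8)[THEN nonzerodivisors_closed] *(1,3,5,7)
    have "(a \<otimes> b) \<otimes> (s' \<otimes> t') = (a \<otimes> s') \<otimes> (b \<otimes> t')"
      using closed by algebra
    also have "\<dots> = (a' \<otimes> b') \<otimes> (s \<otimes> t)"
      unfolding eq using closed by algebra
    finally show "frac (a \<otimes> b) (s \<otimes> t) = frac (a' \<otimes> b') (s' \<otimes> t')"
      using * by (simp add: frac_eq_iff nonzerodivisors_mult)
  qed
  from UN_equiv_class2[OF equiv_fraction_rel equiv_fraction_rel this, of "(a, s)" "(b, t)"] assms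
  show ?thesis
    by (simp add: classical_quotients_def localization_def fraction_def)
qed

lemma classical_quotients_add:
  assumes "a \<in> carrier R" "s \<in> nonzerodivisors R" "b \<in> carrier R" "t \<in> nonzerodivisors R"
  shows "frac a s \<oplus>\<^bsub>classical_quotients R\<^esub> frac b t = frac (a \<otimes> t \<oplus> b \<otimes> s) (s \<otimes> t)"
proof -
  let ?r = "fraction_rel R (nonzerodivisors R)"
  let ?f = "\<lambda>x y. frac (fst x \<otimes> snd y \<oplus> fst y \<otimes> snd x) (snd x \<otimes> snd y)"
  have "congruent2 ?r ?r ?f"
  proof (rule congruent2I', clarsimp simp: fraction_rel_iff)
    fix a s a' s' b t b' t'
    assume *: "a \<in> carrier R" "s \<in> nonzerodivisors R" "a' \<in> carrier R" "s' \<in> nonzerodivisors R"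
      "b \<in> carrier R" "t \<in> nonzerodivisors R" "b' \<in> carrier R" "t' \<in> nonzerodivisors R"
      and eq: "a \<otimes> s' = a' \<otimes> s" "b \<otimes> t' = b' \<otimes> t"
    note closed = *(2,4,6,8)[THEN nonzerodivisors_closed] *(1,3,5,7)
    have "(a \<otimes> t \<oplus> b \<otimes> s) \<otimes> (s' \<otimes> t') = (a \<otimes> s') \<otimes> (t \<otimes> t') \<oplus> (b \<otimes> t') \<otimes> (s \<otimes> s')"
      using closed by algebra
    also have "\<dots> = (a' \<otimes> t' \<oplus> b' \<otimes> s') \<otimes> (s \<otimes> t)"
      unfolding eq using closed by algebra
    finally show "frac (a \<otimes> t \<oplus> b \<otimes> s) (s \<otimes> t) = frac (a' \<otimes> t' \<oplus> b' \<otimes> s') (s' \<otimes> t')"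
      using * closed by (simp add: frac_eq_iff nonzerodivisors_mult)
  qed
  from UN_equiv_class2[OF equiv_fraction_rel equiv_fraction_rel this, of "(a, s)" "(b, t)"] assms
  show ?thesis
    by (simp add: classical_quotients_def localization_def fraction_def)
qed

section \<open>The ring of quotients as a module over \<open>R\<close>\<close>

abbreviation Q_module :: "('a, ('a \<times> 'a) set) module"
  where "Q_module \<equiv> module_via (to_classical_quotients R) (classical_quotients R)"

lemma Q_module_simps:
  "carrier Q_module = {frac a s | a s. a \<in> carrier R \<and> s \<in> nonzerodivisors R}"
  "\<zero>\<^bsub>Q_module\<^esub> = frac \<zero> \<one>"
  by (auto simp: module_via_def carrier_classical_quotients)
    (simp_all add: classical_quotients_def localization_def)

lemma frac_closed:
  assumes "a \<in> carrier R" "s \<in> nonzerodivisors R"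
  shows "frac a s \<in> carrier Q_module"
  using assms by (auto simp: Q_module_simps)

lemma Q_module_add:
  assumes "a \<in> carrier R" "s \<in> nonzerodivisors R" "b \<in> carrier R" "t \<in> nonzerodivisors R"
  shows "frac a s \<oplus>\<^bsub>Q_module\<^esub> frac b t = frac (a \<otimes> t \<oplus> b \<otimes> s) (s \<otimes> t)"
  using classical_quotients_add[OF assms] by (simp add: module_via_def)

lemma Q_module_smult:
  assumes "r \<in> carrier R" "a \<in> carrier R" "s \<in> nonzerodivisors R"
  shows "r \<odot>\<^bsub>Q_module\<^esub> frac a s = frac (r \<otimes> a) s"
  using classical_quotients_mult[OF assms(1) nonzerodivisors_one assms(2,3)] assms
  by (simp add: module_via_def to_classical_quotients_def nonzerodivisors_closed)

lemma frac_eqI: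
  assumes "a \<otimes> t = b \<otimes> s"
    and "a \<in> carrier R" "s \<in> nonzerodivisors R" "b \<in> carrier R" "t \<in> nonzerodivisors R"
  shows "frac a s = frac b t"
  using assms by (simp add: frac_eq_iff)

lemma Q_module_is_module: "module R Q_module"
proof -
  have carE: thesis
    if "x \<in> carrier Q_module" "\<And>a s. a \<in> carrier R \<Longrightarrow> s \<in> nonzerodivisors R \<Longrightarrow> s \<in> carrier R \<Longrightarrow> x = frac a s \<Longrightarrow> thesis"
    for x thesis
    using that nonzerodivisors_closed by (auto simp: Q_module_simps)
  note [simp] = frac_closed Q_module_simps(2) Q_module_add Q_module_smult nonzerodivisors_mult
    nonzerodivisors_one
  show ?thesis
  proof (rule moduleI)
    show "abelian_group Q_module"
    proof (rule abelian_groupI)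
      show "\<zero>\<^bsub>Q_module\<^esub> \<in> carrier Q_module"
        by simp
    next
      fix x assume "x \<in> carrier Q_module"
      then show "\<zero>\<^bsub>Q_module\<^esub> \<oplus>\<^bsub>Q_module\<^esub> x = x"
        by (elim carE) simp
    next
      fix x assume "x \<in> carrier Q_module"
      then obtain a s where as: "a \<in> carrier R" "s \<in> nonzerodivisors R" "s \<in> carrier R" "x = frac a s"
        by (rule carE)
      have "(\<ominus> a \<otimes> s \<oplus> a \<otimes> s) \<otimes> \<one> = \<zero> \<otimes> (s \<otimes> s)"
        using as by algebra
      then have "frac (\<ominus> a) s \<oplus>\<^bsub>Q_module\<^esub> x = \<zero>\<^bsub>Q_module\<^esub>"
        using as by (simp, intro frac_eqI) auto
      then show "\<exists>y\<in>carrier Q_module. y \<oplus>\<^bsub>Q_module\<^esub> x = \<zero>\<^bsub>Q_module\<^esub>"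
        using as by (intro bexI[of _ "frac (\<ominus> a) s"]) auto
    next
      fix x y assume "x \<in> carrier Q_module" "y \<in> carrier Q_module"
      then show "x \<oplus>\<^bsub>Q_module\<^esub> y \<in> carrier Q_module" "x \<oplus>\<^bsub>Q_module\<^esub> y = y \<oplus>\<^bsub>Q_module\<^esub> x"
        by (elim carE; simp add: a_comm m_comm)+
    next
      fix x y z assume "x \<in> carrier Q_module" "y \<in> carrier Q_module" "z \<in> carrier Q_module"
      then show "x \<oplus>\<^bsub>Q_module\<^esub> y \<oplus>\<^bsub>Q_module\<^esub> z = x \<oplus>\<^bsub>Q_module\<^esub> (y \<oplus>\<^bsub>Q_module\<^esub> z)"
        by (elim carE) (simp add: l_distr r_distr a_assoc m_ac)
    qed
  next
    fix a x assume "a \<in> carrier R" "x \<in> carrier Q_module"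
    then show "a \<odot>\<^bsub>Q_module\<^esub> x \<in> carrier Q_module"
      by (elim carE) simp
  next
    fix a b x assume ab: "a \<in> carrier R" "b \<in> carrier R" and "x \<in> carrier Q_module"
    from this(3) obtain c s
      where cs: "c \<in> carrier R" "s \<in> nonzerodivisors R" "s \<in> carrier R" "x = frac c s"
      by (rule carE)
    \<comment> \<open>The two sides of this distributive law have denominators \<open>s\<close> and
      \<open>s s\<close>, so comparing numerators is not enough and the fractions must be cross
      multiplied.\<close>
    have "((a \<oplus> b) \<otimes> c) \<otimes> (s \<otimes> s) = (a \<otimes> c \<otimes> s \<oplus> b \<otimes> c \<otimes> s) \<otimes> s"
      using ab cs(1,3) by algebra
    then show "(a \<oplus> b) \<odot>\<^bsub>Q_module\<^esub> x = a \<odot>\<^bsub>Q_module\<^esub> x \<oplus>\<^bsub>Q_module\<^esub> b \<odot>\<^bsub>Q_module\<^esub> x"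
      using ab cs by (simp, intro frac_eqI) auto
  next
    fix a x y assume "a \<in> carrier R" "x \<in> carrier Q_module" "y \<in> carrier Q_module"
    then show "a \<odot>\<^bsub>Q_module\<^esub> (x \<oplus>\<^bsub>Q_module\<^esub> y) = a \<odot>\<^bsub>Q_module\<^esub> x \<oplus>\<^bsub>Q_module\<^esub> a \<odot>\<^bsub>Q_module\<^esub> y"
      by (elim carE) (simp add: r_distr m_assoc)
  next
    fix a b x assume "a \<in> carrier R" "b \<in> carrier R" "x \<in> carrier Q_module"
    then show "(a \<otimes> b) \<odot>\<^bsub>Q_module\<^esub> x = a \<odot>\<^bsub>Q_module\<^esub> (b \<odot>\<^bsub>Q_module\<^esub> x)"
      by (elim carE) (simp add: m_assoc)
  next
    fix x assume "x \<in> carrier Q_module"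
    then show "\<one> \<odot>\<^bsub>Q_module\<^esub> x = x"
      by (elim carE) simp
  qed (rule is_cring)
qed

lemma to_classical_quotients_submodule:
  "submodule (to_classical_quotients R ` carrier R) R Q_module"
proof -
  interpret M: module R Q_module
    by (rule Q_module_is_module)
  note [simp] = to_classical_quotients_def nonzerodivisors_one frac_closed
  show ?thesis
  proof (rule M.submoduleI)
    show "to_classical_quotients R ` carrier R \<subseteq> carrier Q_module"
      by auto
    show "\<zero>\<^bsub>Q_module\<^esub> \<in> to_classical_quotients R ` carrier R"
      by (auto simp: Q_module_simps)
  next
    fix x assume "x \<in> to_classical_quotients R ` carrier R"
    then obtain r where r: "r \<in> carrier R" "x = frac r \<one>"
      by auto
    then have "frac (\<ominus> r) \<one> \<oplus>\<^bsub>Q_module\<^esub> x = \<zero>\<^bsub>Q_module\<^esub>"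
      by (simp add: Q_module_add Q_module_simps l_neg)
    then have "\<ominus>\<^bsub>Q_module\<^esub> x = frac (\<ominus> r) \<one>"
      using r by (intro M.minus_equality) (auto simp: Q_module_simps(2))
    then show "\<ominus>\<^bsub>Q_module\<^esub> x \<in> to_classical_quotients R ` carrier R"
      using r by auto
  qed (auto simp: Q_module_add Q_module_smult)
qed

section \<open>Elements of \<open>Q/R\<close> as classes of fractions\<close>

definition fclass :: "'a \<Rightarrow> 'a \<Rightarrow> ('a \<times> 'a) set set"
  where "fclass a s = to_classical_quotients R ` carrier R +>\<^bsub>Q_module\<^esub> frac a s"

lemma fclass_eqI:
  assumes "a \<otimes> t = b \<otimes> s"
    and "a \<in> carrier R" "s \<in> nonzerodivisors R" "b \<in> carrier R" "t \<in> nonzerodivisors R"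
  shows "fclass a s = fclass b t"
  unfolding fclass_def by (simp only: frac_eqI[OF assms])

lemma Q_mod_R_is_module: "module R (Q_mod_R R)"
  unfolding Q_mod_R_def
  by (intro module.quotient_module_is_module Q_module_is_module to_classical_quotients_submodule)

lemma carrier_Q_mod_R:
  "carrier (Q_mod_R R) = {fclass a s | a s. a \<in> carrier R \<and> s \<in> nonzerodivisors R}"
  by (auto simp: Q_mod_R_def carrier_quotient_module fclass_def Q_module_simps)

lemma fclass_closed:
  assumes "a \<in> carrier R" "s \<in> nonzerodivisors R"
  shows "fclass a s \<in> carrier (Q_mod_R R)"
  using assms by (auto simp: carrier_Q_mod_R)

lemma fclass_add:
  assumes "a \<in> carrier R" "s \<in> nonzerodivisors R" "b \<in> carrier R" "t \<in> nonzerodivisors R"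
  shows "fclass a s \<oplus>\<^bsub>Q_mod_R R\<^esub> fclass b t = fclass (a \<otimes> t \<oplus> b \<otimes> s) (s \<otimes> t)"
  using module.quotient_module_add[OF Q_module_is_module to_classical_quotients_submodule
      frac_closed[OF assms(1,2)] frac_closed[OF assms(3,4)]] assms
  by (simp add: fclass_def Q_mod_R_def Q_module_add)

lemma fclass_smult:
  assumes "r \<in> carrier R" "a \<in> carrier R" "s \<in> nonzerodivisors R"
  shows "r \<odot>\<^bsub>Q_mod_R R\<^esub> fclass a s = fclass (r \<otimes> a) s"
  using module.quotient_module_smult[OF Q_module_is_module to_classical_quotients_submodule
      assms(1) frac_closed[OF assms(2,3)]] assms
  by (simp add: fclass_def Q_mod_R_def Q_module_smult)

text \<open>Equality of classes means \<open>a/s = r + b/t\<close> in \<open>Q\<close> for some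
  \<open>r\<close> in \<open>R\<close>; clearing the denominators gives the stated equation.\<close>

lemma fclass_eq_iff:
  assumes "a \<in> carrier R" "s \<in> nonzerodivisors R" "b \<in> carrier R" "t \<in> nonzerodivisors R"
  shows "fclass a s = fclass b t \<longleftrightarrow> (\<exists>r\<in>carrier R. a \<otimes> t = b \<otimes> s \<oplus> r \<otimes> s \<otimes> t)"
proof -
  note closed = assms(1,3) assms(2,4)[THEN nonzerodivisors_closed]
  have "fclass a s = fclass b t \<longleftrightarrow>
      (\<exists>r\<in>carrier R. frac a s = frac r \<one> \<oplus>\<^bsub>Q_module\<^esub> frac b t)"
    using module.quotient_module_eq_iff[OF Q_module_is_module to_classical_quotients_submodule
        frac_closed[OF assms(1,2)] frac_closed[OF assms(3,4)]]
    by (simp add: fclass_def to_classical_quotients_def)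
  also have "\<dots> \<longleftrightarrow> (\<exists>r\<in>carrier R. a \<otimes> t = (r \<otimes> t \<oplus> b) \<otimes> s)"
    using assms closed by (intro bex_cong) (auto simp: Q_module_add nonzerodivisors_one frac_eq_iff)
  also have "\<dots> \<longleftrightarrow> (\<exists>r\<in>carrier R. a \<otimes> t = b \<otimes> s \<oplus> r \<otimes> s \<otimes> t)"
    using closed by (intro bex_cong) (auto simp: l_distr r_distr a_comm m_ac)
  finally show ?thesis .
qed

lemma Q_mod_R_zero: "\<zero>\<^bsub>Q_mod_R R\<^esub> = fclass \<zero> \<one>"
  using module.quotient_module_zero[OF Q_module_is_module to_classical_quotients_submodule]
  by (simp add: Q_mod_R_def fclass_def Q_module_simps)

lemma fclass_eq_zero_iff:
  assumes "a \<in> carrier R" "s \<in> nonzerodivisors R"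
  shows "fclass a s = \<zero>\<^bsub>Q_mod_R R\<^esub> \<longleftrightarrow> (\<exists>r\<in>carrier R. a = r \<otimes> s)"
  unfolding Q_mod_R_zero using assms
  by (subst fclass_eq_iff) (auto simp: nonzerodivisors_one nonzerodivisors_closed)

section \<open>Principal ideals generated by two elements\<close>

text \<open>An equational form of \<open>Ra + Rb = Rd\<close>: the combination places
  \<open>d\<close> in the sum, the two cofactors place \<open>a\<close> and \<open>b\<close> in
  \<open>Rd\<close>.\<close>

definition bezout_gcd :: "'a \<Rightarrow> 'a \<Rightarrow> 'a \<Rightarrow> bool"
  where "bezout_gcd a b d \<longleftrightarrow> d \<in> carrier R \<and>
    (\<exists>x\<in>carrier R. \<exists>y\<in>carrier R. d = x \<otimes> a \<oplus> y \<otimes> b) \<and>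
    (\<exists>a'\<in>carrier R. a = a' \<otimes> d) \<and> (\<exists>b'\<in>carrier R. b = b' \<otimes> d)"

lemma bezout_gcdE:
  assumes "bezout_gcd a b d"
  obtains x y a' b' where "d \<in> carrier R" "x \<in> carrier R" "y \<in> carrier R" "a' \<in> carrier R" "b' \<in> carrier R"
    "d = x \<otimes> a \<oplus> y \<otimes> b" "a = a' \<otimes> d" "b = b' \<otimes> d"
  using assms unfolding bezout_gcd_def by metis

lemma bezout_gcdI:
  assumes "d \<in> carrier R" "x \<in> carrier R" "y \<in> carrier R" "a' \<in> carrier R" "b' \<in> carrier R"
    "d = x \<otimes> a \<oplus> y \<otimes> b" "a = a' \<otimes> d" "b = b' \<otimes> d"
  shows "bezout_gcd a b d"
  using assms unfolding bezout_gcd_def by metis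

lemma bezout_gcd_exists:
  assumes "bezout_cring R" and a: "a \<in> carrier R" and b: "b \<in> carrier R"
  obtains d where "bezout_gcd a b d"
proof -
  interpret bezout_cring R
    by (rule assms(1))
  obtain d where d: "d \<in> carrier R" "Idl {a, b} = PIdl d"
    using principalideal.generate[OF finitely_generated_principal[of "{a, b}"]] a b
    by (auto simp: cgenideal_eq_genideal)
  \<comment> \<open>The combinations of \<open>a\<close> and \<open>b\<close> form an ideal
    containing both, hence containing the generated ideal and its generator \<open>d\<close>; this
    yields the Bezout coefficients.\<close>
  let ?J = "{x \<otimes> a \<oplus> y \<otimes> b | x y. x \<in> carrier R \<and> y \<in> carrier R}"
  have "?J = PIdl a <+> PIdl b"
    by (auto simp: set_add_def' cgenideal_def)
  then have "ideal ?J R"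
    using a b add_ideals cgenideal_ideal by metis
  moreover have "a = \<one> \<otimes> a \<oplus> \<zero> \<otimes> b" "b = \<zero> \<otimes> a \<oplus> \<one> \<otimes> b"
    using a b by auto
  then have "{a, b} \<subseteq> ?J"
    by blast
  ultimately have "Idl {a, b} \<subseteq> ?J"
    by (rule genideal_minimal)
  then have "d \<in> ?J"
    using d(2) cgenideal_self[OF d(1)] by blast
  moreover have "a \<in> PIdl d" "b \<in> PIdl d"
    using genideal_self[of "{a, b}"] a b d(2) by auto
  ultimately have "bezout_gcd a b d"
    using d(1) unfolding bezout_gcd_def cgenideal_def by blast
  then show thesis
    by (rule that)
qed

text \<open>Induction on the generating set: if \<open>b\<close> generates the ideal of the elements
  treated so far, a generator of \<open>Ra + Rb\<close> also accounts for the new element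
  \<open>a\<close>.\<close>

lemma bezout_cringI:
  assumes gcd: "\<And>a b. a \<in> carrier R \<Longrightarrow> b \<in> carrier R \<Longrightarrow> \<exists>d. bezout_gcd a b d"
  shows "bezout_cring R"
proof (intro bezout_cring.intro bezout_cring_axioms.intro is_cring)
  fix A assume "finite A" "A \<subseteq> carrier R"
  then have "\<exists>d\<in>carrier R. Idl A = PIdl d"
  proof (induction A)
    case empty
    \<comment> \<open>Every ideal contains zero, so the same ideals contain the empty set and
      \<open>{0}\<close>, and their intersections agree.\<close>
    have "Idl {} = PIdl \<zero>"
      by (simp add: cgenideal_eq_genideal genideal_def)
         (metis additive_subgroup.zero_closed ideal.axioms(1))
    then show ?case
      by blast
  next
    case (insert a A)
    then obtain b where b: "b \<in> carrier R" "Idl A = PIdl b" and a: "a \<in> carrier R" "A \<subseteq> carrier R"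
      by auto
    obtain d where "bezout_gcd a b d"
      using gcd a b by blast
    then obtain x y a' b' where d: "d \<in> carrier R" "x \<in> carrier R" "y \<in> carrier R" "a' \<in> carrier R"
      "b' \<in> carrier R" "d = x \<otimes> a \<oplus> y \<otimes> b" "a = a' \<otimes> d" "b = b' \<otimes> d"
      by (rule bezout_gcdE)
    interpret D: ideal "PIdl d" R
      by (rule cgenideal_ideal[OF d(1)])
    interpret I: ideal "Idl (insert a A)" R
      by (rule genideal_ideal) (use a in auto)
    have "a \<in> PIdl d" "b \<in> PIdl d"
      using d unfolding cgenideal_def by blast+
    moreover have "A \<subseteq> PIdl b"
      using genideal_self[OF a(2)] b by simp
    moreover have "PIdl b \<subseteq> PIdl d"
      using cgenideal_minimal D.ideal_axioms \<open>b \<in> PIdl d\<close> by blast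
    ultimately have "Idl (insert a A) \<subseteq> PIdl d"
      by (intro genideal_minimal D.ideal_axioms) blast
    moreover have "a \<in> Idl (insert a A)" "A \<subseteq> Idl (insert a A)"
      using genideal_self[of "insert a A"] a by auto
    then have "b \<in> Idl (insert a A)"
      using genideal_minimal[OF I.ideal_axioms, of A] b cgenideal_self by blast
    then have "d \<in> Idl (insert a A)"
      unfolding d(6) using \<open>a \<in> Idl _\<close> d by (intro I.a_closed I.I_l_closed)
    then have "PIdl d \<subseteq> Idl (insert a A)"
      by (rule cgenideal_minimal[OF I.ideal_axioms])
    ultimately show ?case
      using d(1) by blast
  qed
  then show "principalideal (Idl A) R"
    using cgenideal_is_principalideal by auto
qed

text \<open>With \<open>ann(r) = Rg\<close>, take \<open>f = 1 - g\<close> and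
  \<open>u = r + g\<close>; then \<open>f u = r\<close> because \<open>g r = 0\<close> and
  \<open>g g = g\<close>. If \<open>x u = 0\<close>, multiplying by \<open>g\<close> gives
  \<open>x g = 0\<close>, hence \<open>x r = 0\<close>, so \<open>x\<close> lies in
  \<open>Rg\<close> and \<open>x = x g = 0\<close>.\<close>

lemma weak_baer_decomposition:
  assumes "weak_baer_cring R" and r: "r \<in> carrier R"
  obtains f u where "f \<in> carrier R" "f \<otimes> f = f" "u \<in> nonzerodivisors R" "r = f \<otimes> u"
proof -
  obtain g where g: "g \<in> carrier R" "g \<otimes> g = g" "annihilator R r = PIdl g"
    using weak_baer_cring.annihilator_idempotent[OF assms] cgenideal_eq_genideal by auto
  have gr: "g \<otimes> r = \<zero>"
    using cgenideal_self[OF g(1)] g(3) by (auto simp: annihilator_def)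
  have "r \<oplus> g \<in> nonzerodivisors R"
  proof (rule nonzerodivisorsI)
    fix x assume x: "x \<in> carrier R" "x \<otimes> (r \<oplus> g) = \<zero>"
    have "x \<otimes> g = (x \<otimes> (r \<oplus> g)) \<otimes> g \<ominus> x \<otimes> (g \<otimes> r) \<oplus> x \<otimes> (g \<ominus> g \<otimes> g)"
      using x(1) g(1) r by algebra
    then have xg: "x \<otimes> g = \<zero>"
      using x g r by (simp add: gr minus_eq r_neg)
    have "x \<otimes> r = x \<otimes> (r \<oplus> g) \<ominus> x \<otimes> g"
      using x(1) g(1) r by algebra
    then have "x \<otimes> r = \<zero>"
      using x g(1) xg by (simp add: minus_eq)
    then have "x \<in> PIdl g"
      using x(1) g(3) by (auto simp: annihilator_def)
    then obtain c where "c \<in> carrier R" "x = c \<otimes> g"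
      by (auto simp: cgenideal_def)
    then show "x = \<zero>"
      using xg g by (simp add: m_assoc)
  qed (use r g in simp)
  moreover have "(\<one> \<ominus> g) \<otimes> (\<one> \<ominus> g) = (\<one> \<ominus> g) \<ominus> (g \<ominus> g \<otimes> g)"
    using g(1) by algebra
  then have "(\<one> \<ominus> g) \<otimes> (\<one> \<ominus> g) = \<one> \<ominus> g"
    using g by (simp add: minus_eq r_neg)
  moreover have "r = (\<one> \<ominus> g) \<otimes> (r \<oplus> g) \<oplus> g \<otimes> r \<ominus> (g \<ominus> g \<otimes> g)"
    using g(1) r by algebra
  then have "r = (\<one> \<ominus> g) \<otimes> (r \<oplus> g)"
    using g r gr by (simp add: minus_eq r_neg)
  ultimately show thesis
    using that[of "\<one> \<ominus> g" "r \<oplus> g"] g(1) by simp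
qed

section \<open>Morphic trivial extensions\<close>

abbreviation T :: "('a \<times> ('a \<times> 'a) set set) ring"
  where "T \<equiv> R \<propto> Q_mod_R R"

lemma T_cring: "cring T"
  by (rule module.trivial_extension_cring[OF Q_mod_R_is_module])

text \<open>This is one half of the partner relation; the other half is the same statement with
  \<open>(f, u)\<close> and \<open>(e, t)\<close> exchanged. The generators multiply to zero because
  \<open>e f = 0\<close> and \<open>e + f\<close> lies in \<open>R\<close>. Conversely, an
  annihilating pair is analysed by multiplying its second-coordinate equation by \<open>e\<close>
  and by \<open>f\<close>.\<close>

lemma annihilator_idempotent_pair:
  assumes f: "f \<in> carrier R" "f \<otimes> f = f"
    and e: "e = \<one> \<ominus> f"
    and t: "t \<in> nonzerodivisors R" and u: "u \<in> nonzerodivisors R"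
  shows "annihilator T (f \<otimes> u, fclass e t) = PIdl\<^bsub>T\<^esub> (e \<otimes> t, fclass f u)"
proof
  interpret M: module R "Q_mod_R R"
    by (rule Q_mod_R_is_module)
  interpret T: cring T
    by (rule T_cring)
  note [simp] = fclass_closed fclass_smult fclass_add nonzerodivisors_mult
  have e_closed: "e \<in> carrier R"
    using f by (simp add: e)
  have ef: "e \<otimes> f = \<zero>"
  proof -
    have "e \<otimes> f = f \<ominus> f \<otimes> f"
      unfolding e using f(1) by algebra
    then show ?thesis
      using f by (simp add: minus_eq r_neg)
  qed
  have ee: "e \<otimes> e = e"
  proof -
    have "e \<otimes> e = e \<ominus> e \<otimes> f"
      using f(1) unfolding e by algebra
    then show ?thesis
      using e_closed ef by (simp add: minus_eq)
  qed
  have fe: "f \<oplus> e = \<one>"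
    unfolding e using f(1) by algebra
  note car = f(1) e_closed nonzerodivisors_closed[OF t] nonzerodivisors_closed[OF u]
  show "annihilator T (f \<otimes> u, fclass e t) \<subseteq> PIdl\<^bsub>T\<^esub> (e \<otimes> t, fclass f u)"
  proof
    fix z assume "z \<in> annihilator T (f \<otimes> u, fclass e t)"
    then obtain x b s where z: "z = (x, fclass b s)" and x: "x \<in> carrier R"
      and b: "b \<in> carrier R" and s: "s \<in> nonzerodivisors R"
      and eq: "(x, fclass b s) \<otimes>\<^bsub>T\<^esub> (f \<otimes> u, fclass e t) = \<zero>\<^bsub>T\<^esub>"
      by (auto simp: annihilator_def carrier_Q_mod_R)
    note car = car x b nonzerodivisors_closed[OF s]
    have xfu: "x \<otimes> (f \<otimes> u) = \<zero>"
      and frac0: "fclass (x \<otimes> e) t \<oplus>\<^bsub>Q_mod_R R\<^esub> fclass (f \<otimes> u \<otimes> b) s = \<zero>\<^bsub>Q_mod_R R\<^esub>"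
      using eq car t s by auto
    have "x \<otimes> f = \<zero>"
      using xfu car u by (simp add: nonzerodivisors_mult_eq_zero flip: m_assoc)
    moreover have "x \<otimes> e = x \<ominus> x \<otimes> f"
      unfolding e using car by algebra
    ultimately have xe: "x \<otimes> e = x"
      using car by (simp add: minus_eq)
    \<comment> \<open>Vanishing in \<open>Q/R\<close> means that \<open>x e/t + f u b/s\<close> is
      an element \<open>r\<close> of \<open>R\<close>; this \<open>r\<close> becomes the first
      coordinate of the multiplier.\<close>
    obtain r where r: "r \<in> carrier R" and r_eq: "x \<otimes> e \<otimes> s \<oplus> f \<otimes> u \<otimes> b \<otimes> t = r \<otimes> (t \<otimes> s)"
      using frac0 car t s by (auto simp: fclass_eq_zero_iff)
    note car = car r
    \<comment> \<open>Multiplying the equation for \<open>r\<close> by \<open>e\<close> removes the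
      \<open>f\<close>-term and leaves \<open>x = r e t\<close>.\<close>
    have "x \<otimes> s = (x \<otimes> e) \<otimes> s"
      by (simp only: xe)
    also have "\<dots> = x \<otimes> (e \<otimes> e) \<otimes> s"
      by (simp only: ee)
    also have "\<dots> = e \<otimes> (x \<otimes> e \<otimes> s \<oplus> f \<otimes> u \<otimes> b \<otimes> t) \<ominus> (e \<otimes> f) \<otimes> (u \<otimes> b \<otimes> t)"
      using car by algebra
    also have "\<dots> = r \<otimes> e \<otimes> t \<otimes> s"
      unfolding r_eq ef using car by algebra
    finally have x_eq: "x = r \<otimes> e \<otimes> t"
      using nonzerodivisors_cancel[OF s, of x "r \<otimes> e \<otimes> t"] car by simp
    \<comment> \<open>Multiplying by \<open>f\<close> instead removes the \<open>e\<close>-term and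
      leaves \<open>f b/s = r f/u\<close>.\<close>
    have "(f \<otimes> u \<otimes> b) \<otimes> t = (f \<otimes> f) \<otimes> u \<otimes> b \<otimes> t"
      by (simp only: f(2))
    also have "\<dots> = f \<otimes> (x \<otimes> e \<otimes> s \<oplus> f \<otimes> u \<otimes> b \<otimes> t) \<ominus> (e \<otimes> f) \<otimes> (x \<otimes> s)"
      using car by algebra
    also have "\<dots> = (r \<otimes> f \<otimes> s) \<otimes> t"
      unfolding r_eq ef using car by algebra
    finally have fub: "f \<otimes> u \<otimes> b = r \<otimes> f \<otimes> s"
      using nonzerodivisors_cancel[OF t, of "f \<otimes> u \<otimes> b" "r \<otimes> f \<otimes> s"] car by simp
    \<comment> \<open>Split \<open>b/s\<close> into \<open>f b/s + e b/s\<close>. The first summand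
      is \<open>r f/u\<close> and the second is \<open>e t\<close> times \<open>b/(s t)\<close>,
      which dictates the second coordinate of the multiplier.\<close>
    have "b \<otimes> (u \<otimes> (s \<otimes> t)) = (f \<oplus> e) \<otimes> (b \<otimes> (u \<otimes> (s \<otimes> t)))"
      using car by (simp add: fe)
    also have "\<dots> = (f \<otimes> u \<otimes> b) \<otimes> (s \<otimes> t) \<oplus> e \<otimes> (b \<otimes> (u \<otimes> (s \<otimes> t)))"
      using car by algebra
    also have "\<dots> = (r \<otimes> f \<otimes> (s \<otimes> t) \<oplus> (e \<otimes> t \<otimes> b) \<otimes> u) \<otimes> s"
      unfolding fub using car by algebra
    finally have "fclass b s = fclass (r \<otimes> f \<otimes> (s \<otimes> t) \<oplus> (e \<otimes> t \<otimes> b) \<otimes> u) (u \<otimes> (s \<otimes> t))"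
      by (rule fclass_eqI) (use car s t u in simp_all)
    then have "fclass b s = fclass (r \<otimes> f) u \<oplus>\<^bsub>Q_mod_R R\<^esub> fclass (e \<otimes> t \<otimes> b) (s \<otimes> t)"
      using car s t u by simp
    then have "z = (r, fclass b (s \<otimes> t)) \<otimes>\<^bsub>T\<^esub> (e \<otimes> t, fclass f u)"
      using car s t u x_eq by (simp add: z m_assoc)
    then show "z \<in> PIdl\<^bsub>T\<^esub> (e \<otimes> t, fclass f u)"
      using car s t unfolding cgenideal_def
      by (intro CollectI exI[of _ "(r, fclass b (s \<otimes> t))"]) simp
  qed
  have cancel: "fclass (g \<otimes> v \<otimes> g) v = \<zero>\<^bsub>Q_mod_R R\<^esub>"
    if g: "g \<in> carrier R" and v: "v \<in> nonzerodivisors R" for g v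
  proof -
    have "g \<otimes> v \<otimes> g = (g \<otimes> g) \<otimes> v"
      using g nonzerodivisors_closed[OF v] by algebra
    then show ?thesis
      using g v nonzerodivisors_closed[OF v] fclass_eq_zero_iff[of "g \<otimes> v \<otimes> g" v] by blast
  qed
  have "e \<otimes> t \<otimes> (f \<otimes> u) = (e \<otimes> f) \<otimes> (t \<otimes> u)"
    using car by algebra
  then have zero: "(e \<otimes> t, fclass f u) \<otimes>\<^bsub>T\<^esub> (f \<otimes> u, fclass e t) = \<zero>\<^bsub>T\<^esub>"
    using car t u by (simp add: ef cancel del: fclass_add)
  show "PIdl\<^bsub>T\<^esub> (e \<otimes> t, fclass f u) \<subseteq> annihilator T (f \<otimes> u, fclass e t)"
  proof
    fix z assume "z \<in> PIdl\<^bsub>T\<^esub> (e \<otimes> t, fclass f u)"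
    then obtain c where c: "c \<in> carrier T" "z = c \<otimes>\<^bsub>T\<^esub> (e \<otimes> t, fclass f u)"
      by (auto simp: cgenideal_def)
    have gens: "(e \<otimes> t, fclass f u) \<in> carrier T" "(f \<otimes> u, fclass e t) \<in> carrier T"
      using car t u by auto
    have "z \<otimes>\<^bsub>T\<^esub> (f \<otimes> u, fclass e t) = \<zero>\<^bsub>T\<^esub>"
      using T.m_assoc[OF c(1) gens] T.r_null[OF c(1)] by (simp only: c(2) zero)
    moreover have "z \<in> carrier T"
      using T.m_closed[OF c(1) gens(1)] by (simp only: c(2))
    ultimately show "z \<in> annihilator T (f \<otimes> u, fclass e t)"
      by (simp only: annihilator_def mem_Collect_eq)
  qed
qed

lemma morphic_if_bezout_weak_baer:
  assumes bezout: "bezout_cring R" and baer: "weak_baer_cring R"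
  shows "morphic_cring T"
  unfolding cring.morphic_cring_iff[OF T_cring]
proof
  interpret M: module R "Q_mod_R R"
    by (rule Q_mod_R_is_module)
  fix z assume "z \<in> carrier T"
  then obtain r a s where z: "z = (r, fclass a s)" and r: "r \<in> carrier R" and a: "a \<in> carrier R"
    and s: "s \<in> nonzerodivisors R"
    by (auto simp: carrier_Q_mod_R)
  obtain f u where f: "f \<in> carrier R" "f \<otimes> f = f" and u: "u \<in> nonzerodivisors R"
    and r_eq: "r = f \<otimes> u"
    using weak_baer_decomposition[OF baer r] .
  define e where "e = \<one> \<ominus> f"
  have e: "e \<in> carrier R"
    using f by (simp add: e_def)
  have "e \<otimes> e = e \<ominus> (f \<ominus> f \<otimes> f)"
    unfolding e_def using f(1) by algebra
  then have ee: "e \<otimes> e = e"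
    using e f by (simp add: minus_eq r_neg)
  have f_eq: "f = \<one> \<ominus> e"
    unfolding e_def using f(1) by algebra
  \<comment> \<open>Writing \<open>s = t d\<close> and \<open>a = a' d\<close> gives
    \<open>a/s = a' (1/t)\<close>, and \<open>d = x a + y s\<close> gives
    \<open>1/t = x (a/s) + y\<close>. So \<open>a/s\<close> and \<open>1/t\<close> generate the same
    submodule of \<open>Q/R\<close>.\<close>
  obtain d where "bezout_gcd a s d"
    using bezout_gcd_exists[OF bezout a nonzerodivisors_closed[OF s]] .
  then obtain x y a' t where d: "d \<in> carrier R" "x \<in> carrier R" "y \<in> carrier R" "a' \<in> carrier R"
    "t \<in> carrier R" "d = x \<otimes> a \<oplus> y \<otimes> s" "a = a' \<otimes> d" "s = t \<otimes> d"
    by (rule bezout_gcdE)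
  have t: "t \<in> nonzerodivisors R"
    using s d(5,1) unfolding d(8) by (rule nonzerodivisors_factor)
  note car = f(1) e a d(1-5) nonzerodivisors_closed[OF s] nonzerodivisors_closed[OF u]
  note [simp] = fclass_closed fclass_smult nonzerodivisors_mult
  have "\<one> \<otimes> s = (x \<otimes> a) \<otimes> t \<oplus> y \<otimes> t \<otimes> s"
  proof -
    have "\<one> \<otimes> s = t \<otimes> d"
      using car by (simp flip: d(8))
    also have "\<dots> = t \<otimes> (x \<otimes> a \<oplus> y \<otimes> s)"
      by (simp flip: d(6))
    also have "\<dots> = (x \<otimes> a) \<otimes> t \<oplus> y \<otimes> t \<otimes> s"
      using car by algebra
    finally show ?thesis .
  qed
  then have p: "fclass \<one> t = x \<odot>\<^bsub>Q_mod_R R\<^esub> fclass a s"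
    using car s t fclass_eq_iff[of \<one> t "x \<otimes> a" s] by auto
  have "a \<otimes> t = a' \<otimes> (t \<otimes> d)"
    using car by (subst d(7)) algebra
  then have "fclass a s = fclass a' t"
    using car s t by (intro fclass_eqI) (simp_all flip: d(8))
  then have q: "fclass a s = a' \<odot>\<^bsub>Q_mod_R R\<^esub> fclass \<one> t"
    using car t by simp
  \<comment> \<open>Dividing \<open>a/s\<close> further by \<open>u\<close> provides the element
    whose multiple by \<open>r = f u\<close> is the \<open>f\<close>-part of \<open>a/s\<close>; it
    lets that part be absorbed.\<close>
  have "f \<otimes> u \<otimes> a \<otimes> s = f \<otimes> a \<otimes> (u \<otimes> s)"
    using car by algebra
  then have "fclass (f \<otimes> u \<otimes> a) (u \<otimes> s) = fclass (f \<otimes> a) s"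
    using car s u by (intro fclass_eqI) simp_all
  then have y: "(f \<otimes> u) \<odot>\<^bsub>Q_mod_R R\<^esub> fclass a (u \<otimes> s) = f \<odot>\<^bsub>Q_mod_R R\<^esub> fclass a s"
    using car s u by simp
  have fr: "f \<otimes> (f \<otimes> u) = f \<otimes> u"
    using f car by (simp flip: m_assoc)
  have "PIdl\<^bsub>T\<^esub> z = PIdl\<^bsub>T\<^esub> (f \<otimes> u, e \<odot>\<^bsub>Q_mod_R R\<^esub> fclass \<one> t)"
    unfolding z r_eq
    by (rule M.trivial_extension_PIdl_eq[OF _ _ _ _ _ _ _ e_def f(2) fr p q y])
      (use car s t u in simp_all)
  then have PIdl_z: "PIdl\<^bsub>T\<^esub> z = PIdl\<^bsub>T\<^esub> (f \<otimes> u, fclass e t)"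
    using car t by simp
  let ?w = "(f \<otimes> u, fclass e t)" and ?b = "(e \<otimes> t, fclass f u)"
  interpret T: cring T
    by (rule T_cring)
  have w: "?w \<in> carrier T" and b: "?b \<in> carrier T" and z_car: "z \<in> carrier T"
    using car s t u r by (auto simp: z)
  have "annihilator T z = annihilator T ?w"
    by (rule T.annihilator_eq_of_PIdl_eq[OF z_car w PIdl_z])
  then have "annihilator T z = PIdl\<^bsub>T\<^esub> ?b"
    using annihilator_idempotent_pair[OF f e_def t u] by simp
  \<comment> \<open>The same lemma with the two idempotents and the two nonzerodivisors exchanged,
    using \<open>f = 1 - e\<close>.\<close>
  moreover have "annihilator T ?b = PIdl\<^bsub>T\<^esub> z"
    using annihilator_idempotent_pair[OF e ee f_eq u t] PIdl_z by simp
  ultimately show "\<exists>b\<in>carrier T. annihilator T z = PIdl\<^bsub>T\<^esub> b \<and> annihilator T b = PIdl\<^bsub>T\<^esub> z"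
    using b by blast
qed

section \<open>Consequences of a morphic trivial extension\<close>

lemma morphic_trivial_extensionE:
  assumes "morphic_cring T" "z \<in> carrier T"
  obtains s n where "s \<in> carrier R" "n \<in> carrier (Q_mod_R R)"
    "annihilator T z = PIdl\<^bsub>T\<^esub> (s, n)" "annihilator T (s, n) = PIdl\<^bsub>T\<^esub> z"
proof -
  obtain b where "b \<in> carrier T" "annihilator T z = PIdl\<^bsub>T\<^esub> b" "annihilator T b = PIdl\<^bsub>T\<^esub> z"
    using assms cring.morphic_cring_iff[OF T_cring] by blast
  then show thesis
    using that[of "fst b" "snd b"] by (cases b) auto
qed

lemma mem_annihilator_T:
  "w \<in> annihilator T z \<longleftrightarrow> w \<in> carrier T \<and> w \<otimes>\<^bsub>T\<^esub> z = \<zero>\<^bsub>T\<^esub>"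
  by (simp only: annihilator_def mem_Collect_eq)

lemma mem_PIdl_T:
  "w \<in> PIdl\<^bsub>T\<^esub> z \<longleftrightarrow> (\<exists>c\<in>carrier R. \<exists>m\<in>carrier (Q_mod_R R). w = (c, m) \<otimes>\<^bsub>T\<^esub> z)"
  by (auto simp: cgenideal_def)

text \<open>The annihilator of \<open>(0, a/b)\<close> is generated by some \<open>(s, n)\<close>, and
  \<open>b/s\<close> turns out to generate the ideal of \<open>a\<close> and \<open>b\<close>.\<close>

lemma morphic_imp_bezout_gcd_nonzerodivisor:
  assumes morphic: "morphic_cring T" and a: "a \<in> carrier R" and b: "b \<in> nonzerodivisors R"
  shows "\<exists>d. bezout_gcd a b d"
proof -
  interpret M: module R "Q_mod_R R"
    by (rule Q_mod_R_is_module)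
  note [simp] = fclass_closed fclass_smult fclass_eq_zero_iff
  note car = a nonzerodivisors_closed[OF b]
  let ?z = "(\<zero>, fclass a b)"
  have z: "?z \<in> carrier T"
    using a b by simp
  obtain s n where s: "s \<in> carrier R" and n: "n \<in> carrier (Q_mod_R R)"
    and ann_z: "annihilator T ?z = PIdl\<^bsub>T\<^esub> (s, n)" and ann_s: "annihilator T (s, n) = PIdl\<^bsub>T\<^esub> ?z"
    using morphic_trivial_extensionE[OF morphic z] .
  \<comment> \<open>Since \<open>b (a/b)\<close> lies in \<open>R\<close>, the pair
    \<open>(b, 0)\<close> is a multiple of \<open>(s, n)\<close>; this gives \<open>b = c s\<close>,
    and \<open>c\<close> is the intended generator.\<close>
  have "(b, \<zero>\<^bsub>Q_mod_R R\<^esub>) \<in> annihilator T ?z"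
    using car a b m_comm[of b a] by (auto simp: mem_annihilator_T)
  then obtain c where c: "c \<in> carrier R" "b = c \<otimes> s"
    unfolding ann_z mem_PIdl_T by auto
  have s_nzd: "s \<in> nonzerodivisors R"
    using b s c by (intro nonzerodivisors_factor[of s c]) (simp_all add: m_comm)
  \<comment> \<open>The generator itself annihilates \<open>(0, a/b)\<close>, so
    \<open>s a/b\<close> is some \<open>k\<close> in \<open>R\<close>, and cancelling
    \<open>s\<close> shows that \<open>c\<close> divides \<open>a\<close>.\<close>
  have "(s, n) \<in> annihilator T ?z"
    unfolding ann_z mem_PIdl_T using s n
    by (intro bexI[of _ \<one>] bexI[of _ "\<zero>\<^bsub>Q_mod_R R\<^esub>"]) auto
  then have "fclass (s \<otimes> a) b = \<zero>\<^bsub>Q_mod_R R\<^esub>"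
    using car b s n by (simp add: mem_annihilator_T)
  then obtain k where k: "k \<in> carrier R" "s \<otimes> a = k \<otimes> b"
    using car b s by auto
  have "a \<otimes> s = k \<otimes> (c \<otimes> s)"
    using m_comm[OF a s] k(2) by (simp flip: c(2))
  then have "a \<otimes> s = (k \<otimes> c) \<otimes> s"
    using k c s by (simp add: m_assoc)
  then have a_eq: "a = k \<otimes> c"
    using nonzerodivisors_cancel[OF s_nzd] car k c by blast
  \<comment> \<open>Here the second half of the partner relation enters: \<open>(0, 1/s)\<close> is
    a multiple of \<open>(0, a/b)\<close>, so \<open>1/s = x a/b + r\<close> in \<open>Q\<close>.
    Multiplication by \<open>b\<close> expresses \<open>c = b/s\<close> as
    \<open>x a + r b\<close>.\<close>
  have "(\<zero>, fclass \<one> s) \<in> annihilator T (s, n)"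
    using s n s_nzd by (auto simp: mem_annihilator_T intro: bexI[of _ \<one>])
  then obtain x m where x: "x \<in> carrier R" "m \<in> carrier (Q_mod_R R)"
    and eq: "(\<zero>, fclass \<one> s) = (x, m) \<otimes>\<^bsub>T\<^esub> ?z"
    unfolding ann_s mem_PIdl_T by blast
  have "fclass \<one> s = fclass (x \<otimes> a) b"
    using eq x car b by simp
  then obtain r where r: "r \<in> carrier R" "\<one> \<otimes> b = x \<otimes> a \<otimes> s \<oplus> r \<otimes> s \<otimes> b"
    using fclass_eq_iff[of \<one> s "x \<otimes> a" b] x car b s_nzd by auto
  have "c \<otimes> s = \<one> \<otimes> b"
    using car c by simp
  also have "\<dots> = (x \<otimes> a \<oplus> r \<otimes> b) \<otimes> s"
    unfolding r(2) using r(1) x(1) car s by algebra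
  finally have "c = x \<otimes> a \<oplus> r \<otimes> b"
    using nonzerodivisors_cancel[OF s_nzd, of c "x \<otimes> a \<oplus> r \<otimes> b"] car c x r by simp
  moreover have "b = s \<otimes> c"
    using c s m_comm by simp
  ultimately show ?thesis
    using bezout_gcdI[OF c(1) x(1) r(1) k(1) s _ a_eq] by blast
qed

text \<open>First coordinates suffice: \<open>x\<close> kills \<open>r\<close> exactly when
  \<open>(x, 0)\<close> kills \<open>(r, 0)\<close>, and the first coordinate of any multiple of
  \<open>(s, n)\<close> is a multiple of \<open>s\<close>.\<close>

lemma morphic_imp_annihilator_principal:
  assumes morphic: "morphic_cring T" and r: "r \<in> carrier R"
  obtains s where "s \<in> carrier R" "annihilator R r = PIdl s"
proof -
  interpret M: module R "Q_mod_R R"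
    by (rule Q_mod_R_is_module)
  let ?z = "(r, \<zero>\<^bsub>Q_mod_R R\<^esub>)"
  have z: "?z \<in> carrier T"
    using r by simp
  obtain s n where s: "s \<in> carrier R" and n: "n \<in> carrier (Q_mod_R R)"
    and ann_z: "annihilator T ?z = PIdl\<^bsub>T\<^esub> (s, n)"
    using morphic_trivial_extensionE[OF morphic z] .
  have "(s, n) \<in> annihilator T ?z"
    unfolding ann_z mem_PIdl_T using s n
    by (intro bexI[of _ \<one>] bexI[of _ "\<zero>\<^bsub>Q_mod_R R\<^esub>"]) auto
  then have sr: "s \<otimes> r = \<zero>"
    by (simp add: mem_annihilator_T)
  have "annihilator R r = PIdl s"
  proof
    show "annihilator R r \<subseteq> PIdl s"
    proof
      fix x assume "x \<in> annihilator R r"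
      then have "(x, \<zero>\<^bsub>Q_mod_R R\<^esub>) \<in> annihilator T ?z"
        using r by (simp add: mem_annihilator_T annihilator_def)
      then show "x \<in> PIdl s"
        unfolding ann_z mem_PIdl_T by (auto simp: cgenideal_def)
    qed
    show "PIdl s \<subseteq> annihilator R r"
      using r s sr by (auto simp: cgenideal_def annihilator_def m_assoc)
  qed
  with s show thesis
    by (rule that)
qed

end

section \<open>Weak Baer and Bezout properties from morphicity over a reduced ring\<close>

context reduced_cring
begin

lemma square_eq_zeroD:
  assumes "x \<in> carrier R" "x \<otimes> x = \<zero>"
  shows "x = \<zero>"
  using nilpotent_imp_zero[of x 2] assms by (simp add: numeral_2_eq_2)

text \<open>If \<open>x (r + s) = 0\<close>, then \<open>s r = 0\<close> makes the square of
  \<open>x r\<close> vanish, so reducedness gives \<open>x r = 0\<close> and hence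
  \<open>x s = 0\<close>. Now \<open>x\<close> lies in \<open>ann(r) = Rs\<close>, so
  \<open>x x\<close> is a multiple of \<open>x s = 0\<close>, and reducedness applies again.\<close>

lemma add_annihilator_generator_nonzerodivisor:
  assumes r: "r \<in> carrier R" and s: "s \<in> carrier R" and ann: "annihilator R r = PIdl s"
  shows "r \<oplus> s \<in> nonzerodivisors R"
proof (rule nonzerodivisorsI)
  have sr: "s \<otimes> r = \<zero>"
    using cgenideal_self[OF s] ann by (auto simp: annihilator_def)
  fix x assume x: "x \<in> carrier R" "x \<otimes> (r \<oplus> s) = \<zero>"
  have "(x \<otimes> r) \<otimes> (x \<otimes> r) = (x \<otimes> (r \<oplus> s)) \<otimes> (x \<otimes> r) \<ominus> (x \<otimes> x) \<otimes> (s \<otimes> r)"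
    using x(1) r s by algebra
  then have "(x \<otimes> r) \<otimes> (x \<otimes> r) = \<zero>"
    using x r sr by (simp add: minus_eq)
  then have xr: "x \<otimes> r = \<zero>"
    using square_eq_zeroD[of "x \<otimes> r"] x(1) r by blast
  then have xs: "x \<otimes> s = \<zero>"
    using x r s by (simp add: r_distr)
  have "x \<in> PIdl s"
    using x(1) xr by (simp add: annihilator_def flip: ann)
  then obtain c where c: "c \<in> carrier R" "x = c \<otimes> s"
    by (auto simp: cgenideal_def)
  have "x \<otimes> x = c \<otimes> (x \<otimes> s)"
    using c(1) x(1) s by (subst (2) c(2)) (rule m_lcomm)
  then have "x \<otimes> x = \<zero>"
    using xs c(1) by simp
  then show "x = \<zero>"
    by (rule square_eq_zeroD[OF x(1)])
qed (use r s in simp)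

lemma morphic_imp_weak_baer:
  assumes morphic: "morphic_cring T"
  shows "weak_baer_cring R"
proof (intro weak_baer_cring.intro weak_baer_cring_axioms.intro is_cring)
  fix r assume r: "r \<in> carrier R"
  obtain s where s: "s \<in> carrier R" and ann: "annihilator R r = PIdl s"
    using morphic_imp_annihilator_principal[OF morphic r] .
  have sr: "s \<otimes> r = \<zero>"
    using cgenideal_self[OF s] ann by (auto simp: annihilator_def)
  \<comment> \<open>\<open>Rr + Ru\<close> equals \<open>Rr + Rs\<close>, but \<open>u\<close> is a
    nonzerodivisor, as the available construction of a common generator requires.\<close>
  define u where "u = r \<oplus> s"
  have u: "u \<in> nonzerodivisors R"
    unfolding u_def by (rule add_annihilator_generator_nonzerodivisor[OF r s ann])
  obtain d where "bezout_gcd r u d"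
    using morphic_imp_bezout_gcd_nonzerodivisor[OF morphic r u] by blast
  then obtain x y r' u' where d: "d \<in> carrier R" "x \<in> carrier R" "y \<in> carrier R" "r' \<in> carrier R"
    "u' \<in> carrier R" "d = x \<otimes> r \<oplus> y \<otimes> u" "r = r' \<otimes> d" "u = u' \<otimes> d"
    by (rule bezout_gcdE)
  note car = r s d(1-5)
  have d_nzd: "d \<in> nonzerodivisors R"
  proof (rule nonzerodivisors_factor)
    show "d \<otimes> u' \<in> nonzerodivisors R"
      using u m_comm[OF d(1,5)] by (simp flip: d(8))
  qed (rule d(1,5))+
  \<comment> \<open>This is the cofactor of \<open>s = u - r\<close> with respect to
    \<open>d\<close>. Likewise \<open>x r + y u = (x + y) r + y s\<close> explains
    \<open>w\<close>.\<close>
  define s' where "s' = u' \<ominus> r'"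
  define w where "w = x \<oplus> y"
  have s'w: "s' \<in> carrier R" "w \<in> carrier R"
    using car by (simp_all add: s'_def w_def)
  have "s = u \<ominus> r"
    unfolding u_def using r s by algebra
  also have "\<dots> = s' \<otimes> d"
    unfolding s'_def by (subst d(7), subst d(8)) (use car in algebra)
  finally have s_eq: "s = s' \<otimes> d" .
  have "\<one> \<otimes> d = x \<otimes> r \<oplus> y \<otimes> u"
    using car by (simp flip: d(6))
  also have "\<dots> = x \<otimes> (r' \<otimes> d) \<oplus> y \<otimes> (u' \<otimes> d)"
    by (simp flip: d(7,8))
  also have "\<dots> = (w \<otimes> r' \<oplus> y \<otimes> s') \<otimes> d"
    unfolding w_def s'_def using car by algebra
  finally have one: "\<one> = w \<otimes> r' \<oplus> y \<otimes> s'"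
    using nonzerodivisors_cancel[OF d_nzd, of \<one> "w \<otimes> r' \<oplus> y \<otimes> s'"] car s'w by simp
  have "(s' \<otimes> r') \<otimes> (d \<otimes> d) = (s' \<otimes> d) \<otimes> (r' \<otimes> d)"
    using car s'w by algebra
  also have "\<dots> = \<zero>"
    using sr by (simp flip: s_eq d(7))
  finally have s'r': "s' \<otimes> r' = \<zero>"
    using nonzerodivisors_mult_eq_zero[OF nonzerodivisors_mult[OF d_nzd d_nzd]] car s'w by simp
  define e where "e = y \<otimes> s'"
  have e: "e \<in> carrier R"
    using car s'w by (simp add: e_def)
  \<comment> \<open>Cancelling \<open>d d\<close> in \<open>s r = 0\<close> gave
    \<open>s' r' = 0\<close>, so multiplying \<open>1 = w r' + y s'\<close> by
    \<open>e = y s'\<close> leaves \<open>e = e e\<close>.\<close>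
  have "e = e \<otimes> (w \<otimes> r' \<oplus> y \<otimes> s')"
    using e by (simp flip: one)
  also have "\<dots> = e \<otimes> e \<oplus> y \<otimes> w \<otimes> (s' \<otimes> r')"
    unfolding e_def using car s'w by algebra
  finally have ee: "e \<otimes> e = e"
    using car s'w e by (simp add: s'r')
  have "annihilator R r = PIdl e"
  proof
    show "annihilator R r \<subseteq> PIdl e"
    proof
      fix z assume "z \<in> annihilator R r"
      then have z: "z \<in> carrier R" "z \<otimes> r = \<zero>"
        by (auto simp: annihilator_def)
      \<comment> \<open>Cancelling \<open>d\<close> shows that \<open>z\<close> kills
        \<open>r'\<close>, so expanding \<open>z\<close> times \<open>1 = w r' + y s'\<close> leaves
        \<open>z = z e\<close>.\<close>
      have "(z \<otimes> r') \<otimes> d = \<zero>"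
        using z car by (simp add: m_assoc flip: d(7))
      then have zr': "z \<otimes> r' = \<zero>"
        using nonzerodivisors_mult_eq_zero[OF d_nzd] z car by simp
      have "z = z \<otimes> (w \<otimes> r' \<oplus> y \<otimes> s')"
        using z by (simp flip: one)
      also have "\<dots> = w \<otimes> (z \<otimes> r') \<oplus> z \<otimes> e"
        unfolding e_def using z(1) car s'w by algebra
      finally have "z = z \<otimes> e"
        using z e s'w by (simp add: zr')
      then show "z \<in> PIdl e"
        using z(1) by (auto simp: cgenideal_def)
    qed
    have "e \<otimes> r = y \<otimes> d \<otimes> (s' \<otimes> r')"
      unfolding e_def by (subst d(7)) (use car s'w in algebra)
    then have "e \<otimes> r = \<zero>"
      using car by (simp add: s'r')
    then show "PIdl e \<subseteq> annihilator R r"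
      using e r by (auto simp: cgenideal_def annihilator_def m_assoc)
  qed
  then show "\<exists>e\<in>carrier R. e \<otimes> e = e \<and> annihilator R r = Idl {e}"
    using e ee cgenideal_eq_genideal by auto
qed

text \<open>Write \<open>a = f u\<close> with \<open>f\<close> idempotent and \<open>u\<close> a
  nonzerodivisor. On the \<open>f\<close>-component \<open>a\<close> agrees with \<open>u\<close>,
  and a generator \<open>d\<close> of \<open>Rb + Ru\<close> is available; on the complementary
  component \<open>a\<close> vanishes and \<open>b\<close> itself generates. Gluing gives
  \<open>h = f d + g b\<close>.\<close>

lemma morphic_imp_bezout:
  assumes morphic: "morphic_cring T"
  shows "bezout_cring R"
proof (rule bezout_cringI)
  fix a b assume a: "a \<in> carrier R" and b: "b \<in> carrier R"
  obtain f u where f: "f \<in> carrier R" "f \<otimes> f = f" and u: "u \<in> nonzerodivisors R"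
    and a_eq: "a = f \<otimes> u"
    using weak_baer_decomposition[OF morphic_imp_weak_baer[OF morphic] a] .
  obtain d where "bezout_gcd b u d"
    using morphic_imp_bezout_gcd_nonzerodivisor[OF morphic b u] by blast
  then obtain x y b' u' where d: "d \<in> carrier R" "x \<in> carrier R" "y \<in> carrier R" "b' \<in> carrier R"
    "u' \<in> carrier R" "d = x \<otimes> b \<oplus> y \<otimes> u" "b = b' \<otimes> d" "u = u' \<otimes> d"
    by (rule bezout_gcdE)
  define g where "g = \<one> \<ominus> f"
  have g: "g \<in> carrier R"
    using f by (simp add: g_def)
  have "f \<otimes> g = f \<ominus> f \<otimes> f"
    unfolding g_def using f(1) by algebra
  then have fg: "f \<otimes> g = \<zero>"
    using f by (simp add: minus_eq r_neg)
  have "g \<otimes> g = g \<ominus> f \<otimes> g"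
    using f(1) unfolding g_def by algebra
  then have gg: "g \<otimes> g = g"
    using fg g by (simp add: minus_eq)
  note car = a b f(1) g d(1-5) nonzerodivisors_closed[OF u]
  define h where "h = f \<otimes> d \<oplus> g \<otimes> b"
  have h: "h \<in> carrier R"
    using car by (simp add: h_def)
  have "h = f \<otimes> (x \<otimes> b \<oplus> y \<otimes> u) \<oplus> g \<otimes> b"
    unfolding h_def by (simp flip: d(6))
  also have "\<dots> = y \<otimes> (f \<otimes> u) \<oplus> (f \<otimes> x \<oplus> g) \<otimes> b"
    using car by algebra
  finally have h_comb: "h = y \<otimes> a \<oplus> (f \<otimes> x \<oplus> g) \<otimes> b"
    by (simp flip: a_eq)
  \<comment> \<open>The cofactors are also glued componentwise: \<open>u'\<close> and
    \<open>0\<close> for \<open>a\<close>, and below \<open>b'\<close> and \<open>1\<close> for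
    \<open>b\<close>.\<close>
  have "(u' \<otimes> f) \<otimes> h = u' \<otimes> (f \<otimes> f) \<otimes> d \<oplus> u' \<otimes> (f \<otimes> g) \<otimes> b"
    unfolding h_def using car by algebra
  also have "\<dots> = f \<otimes> (u' \<otimes> d)"
    unfolding f(2) fg using car by algebra
  finally have a_h: "a = (u' \<otimes> f) \<otimes> h"
    by (simp flip: d(8) a_eq)
  have "(f \<otimes> b' \<oplus> g) \<otimes> h = (f \<otimes> f) \<otimes> (b' \<otimes> d) \<oplus> (f \<otimes> g) \<otimes> (b' \<otimes> b \<oplus> d) \<oplus> (g \<otimes> g) \<otimes> b"
    unfolding h_def using car by algebra
  also have "\<dots> = f \<otimes> b \<oplus> g \<otimes> b"
    unfolding f(2) fg gg using car by (simp flip: d(7))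
  also have "\<dots> = b"
    unfolding g_def using car by algebra
  finally have b_h: "b = (f \<otimes> b' \<oplus> g) \<otimes> h"
    by simp
  show "\<exists>d. bezout_gcd a b d"
    using bezout_gcdI[OF h d(3) _ _ _ h_comb a_h b_h] car by auto
qed

end

theorem corollary4p9:
  fixes R :: "('a, 'm) ring_scheme"
  assumes "reduced_cring R"
  shows "morphic_cring (R \<propto> Q_mod_R R) \<longleftrightarrow> bezout_cring R \<and> weak_baer_cring R"
proof -
  interpret reduced_cring R
    by (rule assms)
  show ?thesis
    using morphic_if_bezout_weak_baer morphic_imp_bezout morphic_imp_weak_baer by blast
qed

end
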